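(* Let $F$ be a finite extension of $\mathbf{Q}_p$ of degree $d$ and let $\mathfrak{X}\subset\mathfrak{B}^d$ be the Schneider–Teitelbaum character variety of $\mathcal{O}_F$. The restriction map $\operatorname{res}_{\mathfrak{X}}:\mathcal{O}^b_{\mathbf{C}_p}(\mathfrak{B}^d)\to\mathcal{O}^b_{\mathbf{C}_p}(\mathfrak{X})$ is an isometry onto its image (for the sup norms).
   Context: $\mathbf{C}_p$ is the completion of an algebraic closure of $\mathbf{Q}_p$. $\mathfrak{B}$ is the rigid analytic open unit disk; fixing a $\mathbf{Z}_p$-basis of $\mathcal{O}_F$, $\mathfrak{B}^d$ parametrizes continuous characters $(\mathcal{O}_F,+)\to\mathbf{C}_p^\times$, and the character variety $\mathfrak{X}\subset\mathfrak{B}^d$ (a 1-dimensional rigid analytic group variety over $F$) is the subvariety parametrizing locally $F$-analytic characters. $\mathcal{O}^b_{\mathbf{C}_p}(\cdot)$ denotes the ring of bounded rigid analytic functions defined over $\mathbf{C}_p$, with the sup norm. Concretely, $\mathcal{O}^b_{\mathbf{C}_p}(\mathfrak{B}^d)\cong\Lambda(\mathcal{O}_F)=\mathbf{C}_p\otimes_{\mathcal{O}_{\mathbf{C}_p}}\mathcal{O}_{\mathbf{C}_p}[\![\mathcal{O}_F]\!]$, $\mathcal{O}^b_{\mathbf{C}_p}(\mathfrak{X})\cong\mathbf{C}_p\otimes_{\mathcal{O}_{\mathbf{C}_p}}\mathcal{O}_{\mathbf{C}_p}[\![X]\!]$ (via $\mathfrak{X}_{\mathbf{C}_p}\cong\mathfrak{B}$,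 $z\mapsto\kappa_z$, $\kappa_z(a)=1+G([a](z))$, where $G$ is a generator of $\operatorname{Hom}_{\mathcal{O}_{\mathbf{C}_p}}(\mathrm{LT},\mathbf{G}_m)$ for the Lubin–Tate formal $\mathcal{O}_F$-module $\mathrm{LT}$ of a uniformizer $\pi$), and $\operatorname{res}_{\mathfrak{X}}$ becomes the algebra homomorphism sending the Dirac measure $\delta_b$ ($b\in\mathcal{O}_F$) to $1+G([b](X))$. *)

theory Defs
  imports "HOL-Analysis.Analysis" "HOL-Computational_Algebra.Primes"
begin

text \<open>Fields that are complete for a multiplicative ultrametric absolute value. (The
  constant \<open>norm\<close> is constrained to real normed vector spaces, hence the new parameter.)\<close>

class complete_ultrametric_field = field_char_0 + complete_space +
  fixes absval :: "'a \<Rightarrow> real"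
  assumes dist_absval: "dist x y = absval (x - y)"
    and absval_mult: "absval (x * y) = absval x * absval y"
    and absval_add_le_max: "absval (x + y) \<le> max (absval x) (absval y)"

text \<open>
  The field of \<open>p\<close>-adic complex numbers is not available in the library. It is described
  here up to isometric isomorphism, as a type \<open>'a\<close> of the class above satisfying \<open>is_Cp p\<close>.
  Once \<open>absval p = 1 / p\<close>, \<open>absval\<close> restricts to the \<open>p\<close>-adic absolute value on
  the rationals, so that \<open>Qp\<close>, the closure of the rationals in a complete space, is the
  completion of the rationals at \<open>p\<close>.
\<close>

definition Qp :: "'a::complete_ultrametric_field set" where
  "Qp = closure \<rat>"

definition Zp :: "'a::complete_ultrametric_field set" where
  "Zp = {x \<in> Qp. absval x \<le> 1}"

definition Qp_bar :: "'a::complete_ultrametric_field set" where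
  "Qp_bar = {x. \<exists>P. P \<noteq> 0 \<and> (\<forall>i. coeff P i \<in> Qp) \<and> poly P x = 0}"

definition is_Cp :: "nat \<Rightarrow> 'a::complete_ultrametric_field itself \<Rightarrow> bool" where
  "is_Cp p T \<longleftrightarrow>
     absval (of_nat p :: 'a) = 1 / real p \<and>
     (\<forall>P :: 'a poly. (\<forall>i. coeff P i \<in> Qp_bar) \<and> degree P > 0 \<longrightarrow> (\<exists>x\<in>Qp_bar. poly P x = 0)) \<and>
     closure (Qp_bar :: 'a set) = UNIV"

definition is_subfield :: "'a::field set \<Rightarrow> bool" where
  "is_subfield F \<longleftrightarrow> 0 \<in> F \<and> 1 \<in> F \<and>
     (\<forall>x\<in>F. \<forall>y\<in>F. x - y \<in> F \<and> x * y \<in> F) \<and> (\<forall>x\<in>F. inverse x \<in> F)"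

text \<open>\<open>e\<close> is a basis of the \<open>R\<close>-submodule \<open>M\<close> of the ambient field.\<close>

definition is_basis :: "'a::field set \<Rightarrow> 'a set \<Rightarrow> ('d::finite \<Rightarrow> 'a) \<Rightarrow> bool" where
  "is_basis R M e \<longleftrightarrow> range e \<subseteq> M \<and>
     (\<forall>x\<in>M. \<exists>!c. range c \<subseteq> R \<and> x = (\<Sum>i\<in>UNIV. c i * e i))"

text \<open>\<open>F\<close> is a finite extension of \<open>Qp\<close> of degree \<open>CARD('d)\<close>.\<close>

definition is_extension_of_Qp ::
    "'d::finite itself \<Rightarrow> 'a::complete_ultrametric_field set \<Rightarrow> bool" where
  "is_extension_of_Qp T F \<longleftrightarrow>
     is_subfield F \<and> Qp \<subseteq> F \<and> (\<exists>b :: 'd \<Rightarrow> 'a. is_basis Qp F b)"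

definition integers_of :: "'a::complete_ultrametric_field set \<Rightarrow> 'a set" where
  "integers_of F = {x \<in> F. absval x \<le> 1}"

text \<open>
  Rigid spaces over \<open>F\<close> enter only through their base change to the \<open>p\<close>-adic complex numbers.
  They are reduced, so functions on them are functions on the sets of points below.
\<close>

definition open_polydisc :: "('a::complete_ultrametric_field ^ 'd::finite) set" where
  "open_polydisc = {z. \<forall>i. absval (z $ i) < 1}"

definition closed_polydisc :: "real \<Rightarrow> ('a::complete_ultrametric_field ^ 'd::finite) set" where
  "closed_polydisc r = {z. \<forall>i. absval (z $ i) \<le> r}"

definition continuous_character ::
    "'a::complete_ultrametric_field set \<Rightarrow> ('a \<Rightarrow> 'a) \<Rightarrow> bool" where
  "continuous_character A \<kappa> \<longleftrightarrow>
     (\<forall>x\<in>A. \<kappa> x \<noteq> 0) \<and> (\<forall>x\<in>A. \<forall>y\<in>A. \<kappa> (x + y) = \<kappa> x * \<kappa> y) \<and> continuous_on A \<kappa>"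

text \<open>
  With \<open>A\<close> the ring of integers of \<open>F\<close>, the expansions are power series in a variable ranging
  over \<open>F\<close>; this is local \<open>F\<close>-analyticity, which is stronger than local analyticity in
  the \<open>CARD('d)\<close> coordinates over \<open>Qp\<close>.
\<close>

definition locally_analytic ::
    "'a::complete_ultrametric_field set \<Rightarrow> ('a \<Rightarrow> 'a) \<Rightarrow> bool" where
  "locally_analytic A \<kappa> \<longleftrightarrow>
     (\<forall>a\<in>A. \<exists>r>0. \<exists>c :: nat \<Rightarrow> 'a. \<forall>x\<in>A. absval (x - a) < r \<longrightarrow>
        (\<lambda>n. c n * (x - a) ^ n) sums \<kappa> x)"

text \<open>
  The point of the open polydisc attached to a continuous character \<open>\<kappa>\<close> has coordinates
  \<open>\<kappa> (e i) - 1\<close>, where \<open>e\<close> is the chosen \<open>Zp\<close>-basis of the ring of integers. It determines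
  \<open>\<kappa>\<close>, and every point of the open polydisc arises in this way.
\<close>

definition character_point ::
    "('d::finite \<Rightarrow> 'a::complete_ultrametric_field) \<Rightarrow> ('a \<Rightarrow> 'a) \<Rightarrow> 'a ^ 'd" where
  "character_point e \<kappa> = (\<chi> i. \<kappa> (e i) - 1)"

definition character_variety ::
    "'a::complete_ultrametric_field set \<Rightarrow> ('d::finite \<Rightarrow> 'a) \<Rightarrow> ('a ^ 'd) set" where
  "character_variety F e = {z \<in> open_polydisc. \<exists>\<kappa>.
     continuous_character (integers_of F) \<kappa> \<and> locally_analytic (integers_of F) \<kappa> \<and>
     z = character_point e \<kappa>}"

text \<open>\<open>f\<close> is given on \<open>S\<close> by the power series with coefficients \<open>c\<close>, indexed by multi-indices.\<close>

definition power_series_on ::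
    "('a ^ 'd) set \<Rightarrow> (('d::finite \<Rightarrow> nat) \<Rightarrow> 'a::complete_ultrametric_field) \<Rightarrow>
     ('a ^ 'd \<Rightarrow> 'a) \<Rightarrow> bool" where
  "power_series_on S c f \<longleftrightarrow>
     (\<forall>z\<in>S. ((\<lambda>n. c n * (\<Prod>i\<in>UNIV. (z $ i) ^ n i)) has_sum f z) UNIV)"

definition rigid_functions_polydisc ::
    "('a::complete_ultrametric_field ^ 'd::finite \<Rightarrow> 'a) set" where
  "rigid_functions_polydisc =
     {f \<in> extensional open_polydisc. \<exists>c. power_series_on open_polydisc c f}"

text \<open>
  For a reduced closed analytic subvariety \<open>X\<close> of the open polydisc, the affinoids
  \<open>X \<inter> closed_polydisc r\<close> for \<open>r < 1\<close> form an admissible covering, and the functions on each of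
  them are the restrictions of the power series converging on \<open>closed_polydisc r\<close>. (As all
  \<open>r < 1\<close> are considered, it does no harm to allow \<open>r\<close> outside the value group.) The power series
  may depend on \<open>r\<close>; in particular, a bounded function on \<open>X\<close> is not required to extend to a
  bounded function on the polydisc.
\<close>

definition rigid_functions ::
    "('a ^ 'd) set \<Rightarrow> ('a::complete_ultrametric_field ^ 'd::finite \<Rightarrow> 'a) set" where
  "rigid_functions X = {f \<in> extensional X. \<forall>r. 0 < r \<and> r < 1 \<longrightarrow>
     (\<exists>c g. power_series_on (closed_polydisc r) c g \<and>
            (\<forall>z \<in> X \<inter> closed_polydisc r. f z = g z))}"

definition bounded_on :: "'b set \<Rightarrow> ('b \<Rightarrow> 'a::complete_ultrametric_field) \<Rightarrow> bool" where
  "bounded_on S f \<longleftrightarrow> (\<exists>M. \<forall>z\<in>S. absval (f z) \<le> M)"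

definition sup_norm :: "'b set \<Rightarrow> ('b \<Rightarrow> 'a::complete_ultrametric_field) \<Rightarrow> real" where
  "sup_norm S f = (SUP z\<in>S. absval (f z))"

definition Ob_polydisc :: "('a::complete_ultrametric_field ^ 'd::finite \<Rightarrow> 'a) set" where
  "Ob_polydisc = {f \<in> rigid_functions_polydisc. bounded_on open_polydisc f}"

definition Ob :: "('a ^ 'd) set \<Rightarrow> ('a::complete_ultrametric_field ^ 'd::finite \<Rightarrow> 'a) set" where
  "Ob X = {f \<in> rigid_functions X. bounded_on X f}"

end

theory Submission
  imports Defs
begin

text \<open>
  The character variety contains the torsion points \<open>(\<zeta> ^ t i - 1)\<close> of the polydisc, because
  characters of finite order are locally constant. Already these points see the sup norm of a
  bounded function \<open>f\<close>. By Cauchy estimates the coefficients of \<open>f\<close> are bounded by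
  \<open>M = sup \<bar>f\<bar>\<close>, so \<open>f\<close> is a limit of combinations of the monomials \<open>u ^ j\<close> in \<open>u = 1 + z\<close>
  with coefficients bounded by \<open>M\<close>. Interpolation at the \<open>p ^ n\<close>-th roots of unity then gives
  \<open>\<bar>f z\<bar> \<le> max (p ^ (n d) A) (M C / p ^ n)\<close>, where \<open>A\<close> is the supremum over torsion points
  and \<open>C\<close> depends on \<open>z\<close> only. The same holds for \<open>f ^ k\<close>, with \<open>A ^ k\<close> and \<open>M ^ k\<close> and the
  same \<open>C\<close>; for large \<open>k\<close> and suitable \<open>n\<close> this excludes \<open>A < M\<close>.
\<close>

section \<open>Ultrametric absolute values\<close>

lemma absval_eq_0_iff [simp]: "absval x = 0 \<longleftrightarrow> x = 0"
  by (metis diff_zero dist_absval dist_eq_0_iff)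

lemma absval_0 [simp]: "absval 0 = 0"
  by simp

lemma absval_nonneg [simp]: "0 \<le> absval x"
  by (metis diff_zero dist_absval zero_le_dist)

lemma absval_1 [simp]: "absval 1 = 1"
  using absval_mult[of 1 1] absval_eq_0_iff[of 1] by simp

lemma absval_minus [simp]: "absval (- x) = absval x"
  by (metis diff_0 diff_zero dist_absval dist_commute)

lemma absval_diff_le_max: "absval (x - y) \<le> max (absval x) (absval y)"
  using absval_add_le_max[of x "- y"] by simp

lemma absval_power: "absval (x ^ n) = absval x ^ n"
  by (induction n) (simp_all add: absval_mult)

lemma absval_root_of_unity:
  assumes "x ^ n = 1" "0 < n"
  shows "absval x = 1"
proof -
  have "absval x ^ n = 1"
    using assms(1) by (simp flip: absval_power)
  then show ?thesis
    using assms(2) by (metis absval_nonneg power_eq_imp_eq_base power_one zero_le_one)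
qed

lemma absval_prod: "absval (prod f A) = (\<Prod>i\<in>A. absval (f i))"
  by (induction A rule: infinite_finite_induct) (simp_all add: absval_mult)

lemma absval_inverse: "absval (inverse x) = inverse (absval x)"
proof (cases "x = 0")
  case False
  then have "absval x * absval (inverse x) = 1"
    by (simp flip: absval_mult)
  then show ?thesis
    using inverse_unique by metis
qed simp

lemma absval_divide: "absval (x / y) = absval x / absval y"
  by (simp add: divide_inverse absval_mult absval_inverse)

lemma absval_sum_le:
  assumes "\<And>i. i \<in> A \<Longrightarrow> absval (f i) \<le> M" "0 \<le> M"
  shows "absval (sum f A) \<le> M"
  using assms(1)
proof (induction A rule: infinite_finite_induct)
  case (insert i A)
  then show ?case
    using absval_add_le_max[of "f i" "sum f A"] by force
qed (simp_all add: assms(2))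

lemma absval_of_nat_le_1 [simp]: "absval (of_nat n :: 'a::complete_ultrametric_field) \<le> 1"
proof (induction n)
  case (Suc n)
  then show ?case
    using absval_add_le_max[of "1 :: 'a" "of_nat n"] by simp
qed simp

lemma absval_of_int_le_1 [simp]: "absval (of_int n) \<le> 1"
  by (cases n rule: int_cases2) (simp_all)

lemma absval_1_plus:
  assumes "absval x < 1"
  shows "absval (1 + x) = 1"
proof -
  have "absval (1 + x) \<le> 1"
    using absval_add_le_max[of 1 x] assms by simp
  moreover have "1 \<le> max (absval (1 + x)) (absval x)"
    using absval_diff_le_max[of "1 + x" x] by simp
  ultimately show ?thesis using assms by simp
qed

text \<open>Exchanging the factors one at a time telescopes the difference; each exchange costs at
  most \<open>M\<close> because the other factors lie in the unit ball.\<close>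

lemma absval_prod_diff_le:
  assumes "finite A" "\<And>i. i \<in> A \<Longrightarrow> absval (f i) \<le> 1" "\<And>i. i \<in> A \<Longrightarrow> absval (g i) \<le> 1"
    and "\<And>i. i \<in> A \<Longrightarrow> absval (f i - g i) \<le> M" "0 \<le> M"
  shows "absval (prod f A - prod g A) \<le> M"
  using assms(1-4)
proof (induction A)
  case (insert i A)
  have "absval (prod g A) \<le> 1"
    unfolding absval_prod using insert.prems by (intro prod_le_1) auto
  then have "absval ((f i - g i) * prod g A) \<le> M * 1"
    unfolding absval_mult using insert.prems assms(5) by (intro mult_mono) auto
  moreover have "absval (f i * (prod f A - prod g A)) \<le> 1 * M"
    unfolding absval_mult using insert assms(5) by (intro mult_mono) auto
  moreover have "f i * prod f A - g i * prod g A
      = f i * (prod f A - prod g A) + (f i - g i) * prod g A"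
    by (simp add: algebra_simps)
  ultimately show ?case
    using absval_add_le_max[of "f i * (prod f A - prod g A)" "(f i - g i) * prod g A"] insert
    by simp
qed (use assms(5) in simp)

lemma absval_power_diff_1_le:
  assumes "absval x \<le> 1"
  shows "absval (x ^ n - 1) \<le> absval (x - 1)"
proof -
  have "x ^ n - 1 = (x - 1) * (\<Sum>i<n. x ^ i)"
    by (rule power_diff_1_eq)
  moreover have "absval (\<Sum>i<n. x ^ i) \<le> 1"
    using assms by (intro absval_sum_le) (simp_all add: absval_power power_le_one)
  ultimately show ?thesis
    by (simp add: absval_mult mult_left_le)
qed

text \<open>Continuity of addition and negation follows from the ultrametric inequality. It makes
  \<open>tendsto_add\<close> and \<open>tendsto_diff\<close> available, for limits in
  \<open>Qp\<close> and for differences of power series.\<close>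

instance complete_ultrametric_field \<subseteq> topological_ab_group_add
proof
  fix a b :: 'a
  show "((\<lambda>x. fst x + snd x) \<longlongrightarrow> a + b) (nhds a \<times>\<^sub>F nhds b)"
  proof (rule tendstoI)
    fix e :: real assume e: "0 < e"
    have "eventually (\<lambda>x. dist (fst x) a < e \<and> dist (snd x) b < e) (nhds a \<times>\<^sub>F nhds b)"
      unfolding eventually_prod_filter using e
      by (intro exI[of _ "\<lambda>x. dist x a < e"] exI[of _ "\<lambda>x. dist x b < e"])
        (auto simp: eventually_nhds_metric)
    then show "\<forall>\<^sub>F x in nhds a \<times>\<^sub>F nhds b. dist (fst x + snd x) (a + b) < e"
    proof eventually_elim
      case (elim x)
      have "fst x + snd x - (a + b) = (fst x - a) + (snd x - b)"
        by simp
      then show ?case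
        using elim absval_add_le_max[of "fst x - a" "snd x - b"]
        unfolding dist_absval by (metis le_less_trans max_less_iff_conj)
    qed
  qed
  show "(uminus \<longlongrightarrow> - a) (nhds a)"
  proof (rule tendstoI)
    fix e :: real assume "0 < e"
    then have "\<forall>\<^sub>F x in nhds a. dist x a < e"
      by (auto simp: eventually_nhds_metric)
    then show "\<forall>\<^sub>F x in nhds a. dist (- x) (- a) < e"
      by eventually_elim (metis absval_minus dist_absval minus_diff_minus)
  qed
qed

text \<open>Reduces questions about power series to finite partial sums. That \<open>K\<close> may
  be any larger finite set lets one index set serve several points at once.\<close>

lemma has_sum_approx:
  fixes f :: "'b \<Rightarrow> 'a::complete_ultrametric_field"
  assumes "(f has_sum S) A" "0 < r"
  obtains J where "finite J" "J \<subseteq> A"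
    "\<And>K. finite K \<Longrightarrow> J \<subseteq> K \<Longrightarrow> K \<subseteq> A \<Longrightarrow> absval (sum f K - S) < r"
proof -
  have "\<forall>\<^sub>F K in finite_subsets_at_top A. dist (sum f K) S < r"
    using assms unfolding has_sum_def by (rule tendstoD)
  then show ?thesis
    using that unfolding eventually_finite_subsets_at_top dist_absval by metis
qed

section \<open>Integers and \<open>p\<close>-th powers\<close>

text \<open>In a Bezout identity \<open>1 = u * p + v * n\<close> the first term has absolute value
  below \<open>1\<close>, so the second term, and with it \<open>n\<close>, has absolute value at
  least \<open>1\<close>.\<close>

lemma absval_of_int_eq_1:
  assumes "prime p" "absval (of_nat p :: 'a::complete_ultrametric_field) = 1 / real p"
    and "\<not> int p dvd n"
  shows "absval (of_int n :: 'a) = 1"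
proof -
  have p: "1 / real p < 1"
    using prime_gt_1_nat[OF assms(1)] by simp
  have "coprime (int p) n"
    using assms(1,3) by (simp add: prime_imp_coprime)
  then obtain u v where "u * int p + v * n = 1"
    using bezout_int[of "int p" n] by auto
  then have "(1::'a) = of_int u * of_nat p + of_int v * of_int n"
    by (metis of_int_1 of_int_add of_int_mult of_int_of_nat_eq)
  then have "1 \<le> max (absval (of_int u * of_nat p :: 'a)) (absval (of_int v * of_int n :: 'a))"
    using absval_add_le_max[of "of_int u * of_nat p :: 'a" "of_int v * of_int n"] by simp
  moreover have "absval (of_int u * of_nat p :: 'a) < 1"
    using mult_right_mono[OF absval_of_int_le_1[of u, where 'a='a], of "1 / real p"] p
    by (simp add: absval_mult assms(2))
  moreover have "absval (of_int v * of_int n :: 'a) \<le> absval (of_int n :: 'a)"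
    using mult_right_mono[OF absval_of_int_le_1[of v, where 'a='a], of "absval (of_int n :: 'a)"]
    by (simp add: absval_mult)
  ultimately show ?thesis
    using absval_of_int_le_1[of n, where 'a='a] by linarith
qed

text \<open>Turns closeness of integers into congruence modulo \<open>p ^ n\<close>, the form needed
  for exponents of roots of unity. For divisibility, once \<open>x = p ^ n * y\<close> the bound
  makes \<open>y\<close> a non-unit, so \<open>p\<close> divides it once more.\<close>

lemma absval_of_int_le_power_iff:
  assumes "prime p" "absval (of_nat p :: 'a::complete_ultrametric_field) = 1 / real p"
  shows "absval (of_int x :: 'a) \<le> (1 / real p) ^ n \<longleftrightarrow> int (p ^ n) dvd x"
proof
  assume "int (p ^ n) dvd x"
  then obtain y where "x = int (p ^ n) * y" by auto
  then have "absval (of_int x :: 'a) = (1 / real p) ^ n * absval (of_int y :: 'a)"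
    by (simp add: absval_mult absval_power assms(2))
  then show "absval (of_int x :: 'a) \<le> (1 / real p) ^ n"
    by (simp add: mult_left_le)
next
  have p: "1 / real p < 1" "0 < real p"
    using prime_gt_1_nat[OF assms(1)] by simp_all
  assume "absval (of_int x :: 'a) \<le> (1 / real p) ^ n"
  then show "int (p ^ n) dvd x"
  proof (induction n)
    case (Suc n)
    have "(1 / real p) ^ Suc n \<le> (1 / real p) ^ n"
      using p by (intro power_decreasing) auto
    with Suc obtain y where y: "x = int (p ^ n) * y"
      by (metis dvdE order_trans)
    then have "(1 / real p) ^ n * absval (of_int y :: 'a) \<le> (1 / real p) ^ n * (1 / real p)"
      using Suc.prems by (simp add: absval_mult absval_power assms(2))
    then have "absval (of_int y :: 'a) \<le> 1 / real p"
      using p by (subst (asm) mult_le_cancel_left_pos) auto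
    then have "int p dvd y"
      using absval_of_int_eq_1[OF assms, of y] p by auto
    then show ?case
      by (simp add: y mult_dvd_mono mult.commute)
  qed simp
qed

section \<open>Powers of elements close to \<open>1\<close>\<close>

lemma one_plus_power_prime:
  fixes x :: "'a::complete_ultrametric_field"
  assumes "prime p" "absval x \<le> 1"
  obtains y where "absval y \<le> 1" "(1 + x) ^ p - 1 = x ^ p + of_nat p * (x * y)"
proof
  \<comment> \<open>The middle binomial terms with one factor \<open>x\<close> and the factor
    \<open>p\<close> of each \<open>p choose k\<close> removed; the remaining coefficients are
    integers.\<close>
  let ?y = "\<Sum>k\<in>{1..<p}. of_nat ((p choose k) div p) * x ^ (k - 1)"
  have p: "1 < p" using assms(1) by (rule prime_gt_1_nat)
  show "absval ?y \<le> 1"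
    using assms(2) by (intro absval_sum_le)
      (auto simp: absval_mult absval_power intro!: mult_le_one power_le_one)
  have "of_nat (p choose k) * x ^ k = of_nat p * (x * (of_nat ((p choose k) div p) * x ^ (k - 1)))"
    if "k \<in> {1..<p}" for k
  proof -
    have "p dvd (p choose k)"
      using that assms(1) by (intro dvd_choose_prime) auto
    then have "of_nat (p choose k) = (of_nat p * of_nat ((p choose k) div p) :: 'a)"
      by (metis dvd_mult_div_cancel of_nat_mult)
    moreover have "x ^ k = x * x ^ (k - 1)"
      using that by (simp add: power_eq_if)
    ultimately show ?thesis by (simp add: mult_ac)
  qed
  then have mid: "(\<Sum>k\<in>{1..<p}. of_nat (p choose k) * x ^ k) = of_nat p * (x * ?y)"
    by (simp add: sum_distrib_left)
  have "(1 + x) ^ p = (\<Sum>k\<le>p. of_nat (p choose k) * x ^ k)"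
    using binomial_ring[of x 1 p] by (simp add: add.commute)
  also have "{..p} = insert 0 (insert p {1..<p})" using p by auto
  also have "(\<Sum>k\<in>insert 0 (insert p {1..<p}). of_nat (p choose k) * x ^ k)
      = 1 + (x ^ p + (\<Sum>k\<in>{1..<p}. of_nat (p choose k) * x ^ k))"
    using p by (subst sum.insert) (auto simp: sum.insert)
  finally show "(1 + x) ^ p - 1 = x ^ p + of_nat p * (x * ?y)"
    using mid by simp
qed

text \<open>In the expansion of \<open>(1 + (x - 1)) ^ p\<close> the top term is at most the square
  of \<open>absval (x - 1)\<close>, as \<open>p \<ge> 2\<close>, and the remaining terms gain a
  factor \<open>1 / p\<close>.\<close>

lemma absval_power_prime_diff_1_le:
  fixes x :: "'a::complete_ultrametric_field"
  assumes "prime p" "absval (of_nat p :: 'a) = 1 / real p" "absval (x - 1) \<le> 1"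
  shows "absval (x ^ p - 1) \<le> absval (x - 1) * max (absval (x - 1)) (1 / real p)"
proof -
  obtain y where y: "absval y \<le> 1"
    "(1 + (x - 1)) ^ p - 1 = (x - 1) ^ p + of_nat p * ((x - 1) * y)"
    using one_plus_power_prime[OF assms(1,3)] by metis
  let ?m = "max (absval (x - 1)) (1 / real p)"
  have "absval (x - 1) ^ p \<le> absval (x - 1) ^ 2"
    using assms(3) prime_ge_2_nat[OF assms(1)] by (intro power_decreasing) auto
  also have "\<dots> \<le> absval (x - 1) * ?m"
    unfolding power2_eq_square by (intro mult_left_mono) auto
  finally have "absval (x - 1) ^ p \<le> absval (x - 1) * ?m" .
  moreover have "absval (of_nat p * ((x - 1) * y)) \<le> absval (x - 1) * ?m"
  proof -
    have "absval (of_nat p * ((x - 1) * y)) \<le> absval (x - 1) * (1 / real p)"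
      using y(1) by (simp add: absval_mult assms(2) mult_left_le divide_right_mono)
    also have "\<dots> \<le> absval (x - 1) * ?m"
      by (intro mult_left_mono) auto
    finally show ?thesis .
  qed
  moreover have "absval (x ^ p - 1) \<le> max (absval (x - 1) ^ p) (absval (of_nat p * ((x - 1) * y)))"
    using y(2) absval_add_le_max[of "(x - 1) ^ p"] by (simp add: absval_power)
  ultimately show ?thesis
    by linarith
qed

text \<open>Frobenius is injective modulo the maximal ideal: \<open>(x - 1) ^ p\<close> differs from
  \<open>x ^ p - 1\<close> by an integral multiple of \<open>p\<close>, so induction on
  \<open>n\<close> applies. This places the torsion points in the open polydisc.\<close>

lemma absval_prime_power_root_diff_1:
  fixes x :: "'a::complete_ultrametric_field"
  assumes "prime p" "absval (of_nat p :: 'a) = 1 / real p" "x ^ (p ^ n) = 1"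
  shows "absval (x - 1) < 1"
  using assms(3)
proof (induction n arbitrary: x)
  case (Suc n)
  have p: "1 < p" using assms(1) by (rule prime_gt_1_nat)
  have "absval x = 1"
    using Suc.prems p by (intro absval_root_of_unity) auto
  then have le: "absval (x - 1) \<le> 1"
    using absval_diff_le_max[of x 1] by simp
  obtain y where y: "absval y \<le> 1"
    "(1 + (x - 1)) ^ p - 1 = (x - 1) ^ p + of_nat p * ((x - 1) * y)"
    using one_plus_power_prime[OF assms(1) le] by metis
  have "absval (x ^ p - 1) < 1"
    using Suc.prems by (intro Suc.IH) (simp flip: power_mult)
  moreover have "absval (of_nat p * ((x - 1) * y)) < 1"
  proof -
    have "absval ((x - 1) * y) \<le> 1"
      using le y(1) by (simp add: absval_mult mult_le_one)
    then have "1 / real p * absval ((x - 1) * y) \<le> 1 / real p * 1"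
      by (intro mult_left_mono) auto
    also have "\<dots> < 1" using p by simp
    finally show ?thesis
      unfolding absval_mult[of "of_nat p"] assms(2) .
  qed
  moreover have "(x - 1) ^ p = x ^ p - 1 - of_nat p * ((x - 1) * y)"
    using y(2) by simp
  ultimately have "absval ((x - 1) ^ p) < 1"
    by (metis absval_diff_le_max le_less_trans max_less_iff_conj)
  then show ?case
    unfolding absval_power by (meson linorder_not_less one_le_power)
qed simp

text \<open>There are two phases: the distance to \<open>1\<close> first decays with ratio
  \<open>\<theta>\<close> until it is below \<open>1 / p\<close>; from then on each
  \<open>p\<close>-th power gains a full factor \<open>1 / p\<close>. The first phase only affects
  \<open>C\<close>.\<close>

lemma absval_power_prime_power_diff_1_bound:
  fixes x :: "'a::complete_ultrametric_field"
  assumes "prime p" "absval (of_nat p :: 'a) = 1 / real p" "absval (x - 1) < 1"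
  obtains C where "\<And>n. absval (x ^ (p ^ n) - 1) \<le> C / real p ^ n"
proof -
  define \<theta> where "\<theta> = max (absval (x - 1)) (1 / real p)"
  have p: "1 < real p" using prime_gt_1_nat[OF assms(1)] by simp
  have \<theta>: "0 < \<theta>" "\<theta> < 1"
    using p assms(3) by (simp_all add: \<theta>_def less_max_iff_disj)
  have step: "absval (x ^ p ^ Suc n - 1)
      \<le> absval (x ^ p ^ n - 1) * max (absval (x ^ p ^ n - 1)) (1 / real p)"
    if "absval (x ^ p ^ n - 1) \<le> 1" for n
    using absval_power_prime_diff_1_le[OF assms(1,2) that] by (simp add: mult.commute flip: power_mult)
  have decay: "absval (x ^ p ^ n - 1) \<le> \<theta> ^ n \<and> absval (x ^ p ^ n - 1) \<le> absval (x - 1)" for n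
  proof (induction n)
    case 0
    then show ?case using assms(3) by simp
  next
    case (Suc n)
    have le1: "absval (x ^ p ^ n - 1) \<le> 1" using Suc assms(3) by simp
    have "absval (x ^ p ^ Suc n - 1) \<le> absval (x ^ p ^ n - 1) * \<theta>"
      using Suc by (intro order_trans[OF step[OF le1] mult_left_mono]) (auto simp: \<theta>_def)
    moreover have "absval (x ^ p ^ n - 1) * \<theta> \<le> \<theta> ^ n * \<theta>"
      using Suc \<theta> by (intro mult_right_mono) auto
    moreover have "absval (x ^ p ^ n - 1) * \<theta> \<le> absval (x ^ p ^ n - 1)"
      using \<theta> by (simp add: mult_left_le)
    ultimately show ?case using Suc by (simp add: mult.commute)
  qed
  obtain n0 where n0: "\<theta> ^ n0 < 1 / real p"
    using real_arch_pow_inv[of "1 / real p" \<theta>] \<theta> p by auto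
  \<comment> \<open>The exponent \<open>Suc m\<close> keeps the distance at most
    \<open>1 / p\<close>, so that the maximum in \<open>step\<close> equals
    \<open>1 / p\<close>.\<close>
  have late: "absval (x ^ p ^ (n0 + m) - 1) \<le> (1 / real p) ^ Suc m" for m
  proof (induction m)
    case 0
    then show ?case using decay[of n0] n0 by simp
  next
    case (Suc m)
    have "(1 / real p) ^ Suc m \<le> (1 / real p) ^ 1"
      using p by (intro power_decreasing) auto
    then have le: "absval (x ^ p ^ (n0 + m) - 1) \<le> 1 / real p" using Suc by simp
    then have le1: "absval (x ^ p ^ (n0 + m) - 1) \<le> 1"
      using p by (intro order_trans[OF le]) simp
    have "absval (x ^ p ^ (n0 + Suc m) - 1) \<le> absval (x ^ p ^ (n0 + m) - 1) * (1 / real p)"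
      using step[OF le1] le by (simp add: max_def split: if_splits)
    also have "\<dots> \<le> (1 / real p) ^ Suc m * (1 / real p)"
      using Suc p by (intro mult_right_mono) auto
    finally show ?case by (simp add: mult.commute)
  qed
  show ?thesis
  proof
    fix n
    \<comment> \<open>The constant \<open>p ^ n0\<close> makes the bound at least \<open>1\<close>,
      hence trivial, for \<open>n < n0\<close>.\<close>
    show "absval (x ^ (p ^ n) - 1) \<le> real p ^ n0 / real p ^ n"
    proof (cases "n0 \<le> n")
      case True
      then obtain m where m: "n = n0 + m" using le_Suc_ex by blast
      have "absval (x ^ p ^ n - 1) \<le> (1 / real p) ^ Suc m" using late m by simp
      also have "\<dots> \<le> (1 / real p) ^ m"
        using p by (intro power_decreasing) auto
      also have "\<dots> = real p ^ n0 / real p ^ n"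
        using p by (simp add: m power_add power_divide)
      finally show ?thesis .
    next
      case False
      then have "real p ^ n \<le> real p ^ n0"
        using p by (intro power_increasing) auto
      then have "1 \<le> real p ^ n0 / real p ^ n" using p by simp
      moreover have "absval (x ^ p ^ n - 1) \<le> 1" using decay[of n] assms(3) by simp
      ultimately show ?thesis by simp
    qed
  qed
qed

section \<open>Roots of unity\<close>

lemma is_Cp_absval:
  "is_Cp p TYPE('a::complete_ultrametric_field) \<Longrightarrow>
    absval (of_nat p :: 'a::complete_ultrametric_field) = 1 / real p"
  by (simp add: is_Cp_def)

text \<open>\<open>is_Cp\<close> supplies roots of polynomials over \<open>Qp_bar\<close>; an
  integer \<open>a\<close> lies there as the root of \<open>X - a\<close>.\<close>

lemma is_Cp_integral_root:
  fixes P :: "'a::complete_ultrametric_field poly"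
  assumes "is_Cp p TYPE('a)" "\<And>i. coeff P i \<in> \<int>" "0 < degree P"
  obtains x where "poly P x = 0"
proof -
  have "coeff P i \<in> Qp_bar" for i
  proof -
    have "\<int> \<subseteq> (Qp :: 'a set)"
      unfolding Qp_def using closure_subset Ints_subset_Rats by blast
    then have "coeff [:- coeff P i, 1:] j \<in> Qp" for j
      using assms(2)[of i] Ints_minus[OF assms(2)[of i]] by (auto simp: coeff_pCons split: nat.split)
    then show ?thesis
      unfolding Qp_bar_def by (intro CollectI exI[of _ "[:- coeff P i, 1:]"]) auto
  qed
  then show ?thesis
    using assms(1,3) that unfolding is_Cp_def by blast
qed

text \<open>For \<open>n = Suc m\<close>, \<open>\<zeta>\<close> is a root of the cyclotomic
  polynomial of index \<open>l ^ n\<close>. If \<open>\<zeta> ^ l ^ m\<close> were \<open>1\<close>,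
  the vanishing sum would equal \<open>l\<close>, which is nonzero in characteristic zero. The case
  \<open>l = p\<close> gives torsion points, the case \<open>l \<noteq> p\<close> the Cauchy
  estimates.\<close>

lemma is_Cp_primitive_root:
  fixes n :: nat
  assumes "is_Cp p TYPE('a::complete_ultrametric_field)" "prime l"
  obtains \<zeta> :: "'a::complete_ultrametric_field" where "\<And>k. \<zeta> ^ k = 1 \<longleftrightarrow> l ^ n dvd k"
proof (cases n)
  case 0
  then show ?thesis by (intro that[of 1]) simp
next
  case (Suc m)
  have l: "1 < l" using assms(2) by (rule prime_gt_1_nat)
  define P :: "'a poly" where "P = (\<Sum>j<l. monom 1 (j * l ^ m))"
  have coeff_P: "coeff P i = (\<Sum>j<l. if j * l ^ m = i then 1 else 0)" for i
    by (simp add: P_def coeff_sum)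
  have "coeff P i \<in> \<int>" for i
    unfolding coeff_P by (intro Ints_sum) auto
  moreover have "coeff P (l ^ m) = 1"
    using l by (subst coeff_P, subst sum.cong[OF refl, of _ _ "\<lambda>j. if j = 1 then 1 else 0"]) auto
  then have "0 < degree P"
    using l le_degree[of P "l ^ m"] by (metis bot_nat_0.not_eq_extremum le_zero_eq not_one_less_zero
        power_not_zero zero_neq_one)
  ultimately obtain \<zeta> where "poly P \<zeta> = 0"
    using is_Cp_integral_root[OF assms(1)] by blast
  then have sum0: "(\<Sum>j<l. (\<zeta> ^ l ^ m) ^ j) = 0"
    by (simp add: P_def poly_sum poly_monom mult.commute flip: power_mult)
  have n1: "\<zeta> ^ l ^ m \<noteq> 1"
    using sum0 l by auto
  have "(\<zeta> ^ l ^ m) ^ l - 1 = 0"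
    using sum0 by (simp add: power_diff_1_eq)
  then have eq1: "\<zeta> ^ l ^ Suc m = 1"
    by (simp add: mult.commute flip: power_mult)
  show ?thesis
  proof
    fix k
    show "\<zeta> ^ k = 1 \<longleftrightarrow> l ^ n dvd k"
    proof
      assume "l ^ n dvd k"
      then obtain r where "k = l ^ n * r" by auto
      then show "\<zeta> ^ k = 1"
        using eq1 by (simp add: Suc power_mult)
    next
      assume k: "\<zeta> ^ k = 1"
      show "l ^ n dvd k"
      proof (rule ccontr)
        assume ndvd: "\<not> l ^ n dvd k"
        then have "k \<noteq> 0" using dvd_0_right by metis
        \<comment> \<open>Bezout replaces \<open>k\<close> by its gcd with \<open>l ^ n\<close>, a
          power \<open>l ^ i\<close>; here \<open>i < n\<close> would force
          \<open>\<zeta> ^ l ^ m = 1\<close>.\<close>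
        then obtain a b where ab: "k * a = l ^ n * b + gcd k (l ^ n)"
          using bezout_nat by blast
        have "\<zeta> ^ gcd k (l ^ n) = \<zeta> ^ (k * a)"
          unfolding ab power_add power_mult using eq1 by (simp add: Suc)
        also have "\<dots> = 1" by (simp add: power_mult k)
        finally have g: "\<zeta> ^ gcd k (l ^ n) = 1" .
        obtain i where i: "i \<le> n" "gcd k (l ^ n) = l ^ i"
          using divides_primepow_nat[OF assms(2), of "gcd k (l ^ n)" n] by auto
        have "i \<noteq> n"
          using i ndvd by (metis gcd_dvd1)
        then have "l ^ i dvd l ^ m"
          using i Suc by (intro le_imp_power_dvd) auto
        then obtain r where "l ^ m = l ^ i * r" by auto
        then have "\<zeta> ^ l ^ m = 1"
          using g i by (simp add: power_mult)
        with n1 show False by simp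
      qed
    qed
  qed
qed

section \<open>Orthogonality for the characters of \<open>(Z/q)^d\<close>\<close>

definition index_box :: "nat \<Rightarrow> ('d \<Rightarrow> nat) set" where
  "index_box q = {t. \<forall>i. t i < q}"

lemma index_box_eq_PiE: "index_box q = PiE UNIV (\<lambda>_. {..<q})"
  by (auto simp: index_box_def PiE_def Pi_def)

lemma finite_index_box [simp]: "finite (index_box q :: ('d::finite \<Rightarrow> nat) set)"
  unfolding index_box_eq_PiE by (intro finite_PiE) auto

text \<open>The sum factors over the coordinates into geometric sums in \<open>w i\<close>, a
  \<open>q\<close>-th root of unity that is \<open>1\<close> exactly when \<open>j i\<close> has
  residue \<open>a i\<close>.\<close>

lemma sum_index_box_roots_of_unity:
  fixes \<zeta> :: "'a::field_char_0" and a j :: "'d::finite \<Rightarrow> nat"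
  assumes prim: "\<And>k. \<zeta> ^ k = 1 \<longleftrightarrow> q dvd k" and a: "a \<in> index_box q"
  shows "(\<Sum>t\<in>index_box q. (\<Prod>i\<in>UNIV. \<zeta> ^ (t i * (q - a i))) * (\<Prod>i\<in>UNIV. (\<zeta> ^ t i) ^ j i))
    = (if \<forall>i. j i mod q = a i then of_nat q ^ CARD('d) else 0)"
proof -
  \<comment> \<open>The exponent \<open>q - a i\<close> stands for \<open>- a i\<close> and is a
    natural number because \<open>a i < q\<close>.\<close>
  define w where "w i = \<zeta> ^ (q - a i + j i)" for i
  have lt: "a i < q" for i using a by (simp add: index_box_def)
  have w1: "w i = 1 \<longleftrightarrow> j i mod q = a i" for i
  proof -
    have "w i = 1 \<longleftrightarrow> (q - a i + j i) mod q = 0"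
      by (simp add: w_def prim dvd_eq_mod_eq_0)
    also have "\<dots> \<longleftrightarrow> (q - a i + j i mod q) mod q = 0"
      by (simp add: mod_simps)
    also have "\<dots> \<longleftrightarrow> j i mod q = a i"
    proof
      assume "(q - a i + j i mod q) mod q = 0"
      then obtain r where r: "q - a i + j i mod q = q * r" by (auto simp: mod_eq_0_iff_dvd)
      moreover have "j i mod q < q" using lt[of i] by simp
      ultimately have "q * r < q * 2" "0 < q * r" using lt[of i] by linarith+
      then have "r = 1" by auto
      then show "j i mod q = a i" using r lt[of i] by simp
    qed (use lt[of i] in simp)
    finally show ?thesis .
  qed
  have wq: "w i ^ q = 1" for i
    unfolding w_def by (metis dvd_triv_right power_mult prim)
  have geo: "(\<Sum>s<q. w i ^ s) = (if j i mod q = a i then of_nat q else 0)" for i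
  proof (cases "w i = 1")
    case True
    then show ?thesis using w1[of i] by simp
  next
    case False
    then show ?thesis using w1[of i] wq[of i] power_diff_1_eq[of "w i" q] by simp
  qed
  have "(\<Prod>i\<in>UNIV. \<zeta> ^ (t i * (q - a i))) * (\<Prod>i\<in>UNIV. (\<zeta> ^ t i) ^ j i) = (\<Prod>i\<in>UNIV. w i ^ t i)"
    for t
    unfolding w_def by (simp add: algebra_simps power_add flip: prod.distrib power_mult)
  then have "(\<Sum>t\<in>index_box q. (\<Prod>i\<in>UNIV. \<zeta> ^ (t i * (q - a i))) * (\<Prod>i\<in>UNIV. (\<zeta> ^ t i) ^ j i))
      = (\<Sum>t\<in>PiE UNIV (\<lambda>_. {..<q}). \<Prod>i\<in>UNIV. w i ^ t i)"
    by (simp add: index_box_eq_PiE)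
  also have "\<dots> = (\<Prod>i\<in>UNIV. \<Sum>s<q. w i ^ s)"
    by (subst prod_sum_PiE) auto
  also have "\<dots> = (if \<forall>i. j i mod q = a i then of_nat q ^ CARD('d) else 0)"
    unfolding geo by auto
  finally show ?thesis .
qed

section \<open>Interpolation at roots of unity\<close>

text \<open>For \<open>M \<ge> 0\<close> these are the functions of polynomials with Gauss norm at
  most \<open>M\<close>, generated by single terms so that additive estimates can be proved by
  induction. The variable is \<open>u = 1 + z\<close>, in which torsion points have roots of unity
  as coordinates.\<close>

inductive_set monomial_span ::
    "real \<Rightarrow> (('d::finite \<Rightarrow> 'a::complete_ultrametric_field) \<Rightarrow> 'a) set" for M where
  monomial: "absval c \<le> M \<Longrightarrow> (\<lambda>u. c * (\<Prod>i\<in>UNIV. u i ^ j i)) \<in> monomial_span M"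
| add: "f \<in> monomial_span M \<Longrightarrow> g \<in> monomial_span M \<Longrightarrow> (\<lambda>u. f u + g u) \<in> monomial_span M"

lemma monomial_span_const: "absval c \<le> M \<Longrightarrow> (\<lambda>u. c) \<in> monomial_span M"
  using monomial_span.monomial[of c M "\<lambda>_. 0"] by simp

lemma monomial_span_mult:
  assumes "f \<in> monomial_span M" "g \<in> monomial_span N" "0 \<le> M"
  shows "(\<lambda>u. f u * g u) \<in> monomial_span (M * N)"
  using assms(1)
proof induction
  case (monomial c j)
  from assms(2) show ?case
  proof induction
    case (monomial c' j')
    have "(\<lambda>u. c * c' * (\<Prod>i\<in>UNIV. u i ^ (j i + j' i))) \<in> monomial_span (M * N)"
      using monomial \<open>absval c \<le> M\<close> assms(3)
      by (intro monomial_span.monomial) (auto simp: absval_mult intro: mult_mono)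
    then show ?case
      by (simp add: power_add prod.distrib mult_ac)
  next
    case (add f g)
    then show ?case
      using monomial_span.add[OF add.IH] by (simp add: distrib_left)
  qed
next
  case (add f1 f2)
  then show ?case
    using monomial_span.add[OF add.IH] by (simp add: distrib_right)
qed

text \<open>Ultrametric coefficient bounds acquire no combinatorial constants, so the bound is
  exactly \<open>M ^ k\<close>; the passage to high powers of a function relies on this.\<close>

lemma monomial_span_power:
  assumes "f \<in> monomial_span M" "0 \<le> M"
  shows "(\<lambda>u. f u ^ k) \<in> monomial_span (M ^ k)"
  using assms by (induction k) (auto intro: monomial_span_const monomial_span_mult)

lemma monomial_span_prod:
  assumes "\<And>i. i \<in> A \<Longrightarrow> f i \<in> monomial_span 1"
  shows "(\<lambda>u. \<Prod>i\<in>A. f i u) \<in> monomial_span 1"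
  using assms
  by (induction A rule: infinite_finite_induct)
    (auto intro: monomial_span_const monomial_span_mult[of _ 1 _ 1, simplified])

lemma monomial_span_sum:
  assumes "\<And>i. i \<in> A \<Longrightarrow> f i \<in> monomial_span M" "0 \<le> M"
  shows "(\<lambda>u. \<Sum>i\<in>A. f i u) \<in> monomial_span M"
  using assms
  by (induction A rule: infinite_finite_induct) (auto intro: monomial_span_const monomial_span.add)

lemma monomial_span_var_diff_1:
  fixes i :: "'d::finite"
  shows "(\<lambda>u. u i - 1 :: 'a::complete_ultrametric_field) \<in> monomial_span 1"
proof -
  have "(\<Prod>k\<in>UNIV. u k ^ (if k = i then 1 else 0)) = u i" for u :: "'d \<Rightarrow> 'a"
    by (subst prod.cong[OF refl, of _ _ "\<lambda>k. if k = i then u k else 1"]) auto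
  then have "(\<lambda>u. u i :: 'a) \<in> monomial_span 1"
    using monomial_span.monomial[of "1::'a" 1 "\<lambda>k. if k = i then 1 else 0"] by simp
  then show ?thesis
    using monomial_span.add[OF _ monomial_span_const[of "- 1 :: 'a" 1], of "\<lambda>u. u i"] by simp
qed

text \<open>The substitution \<open>z = u - 1\<close> has integer coefficients, so rewriting in
  powers of \<open>u\<close> does not increase the coefficient bound.\<close>

lemma polynomial_in_monomial_span:
  fixes c :: "('d::finite \<Rightarrow> nat) \<Rightarrow> 'a::complete_ultrametric_field"
  assumes "\<And>n. absval (c n) \<le> M" "0 \<le> M"
  shows "(\<lambda>u. \<Sum>n\<in>J. c n * (\<Prod>i\<in>UNIV. (u i - 1) ^ n i)) \<in> monomial_span M"
proof (intro monomial_span_sum)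
  fix n :: "'d \<Rightarrow> nat"
  have "(\<lambda>u. (\<Prod>i\<in>UNIV. (u i - 1) ^ n i) :: 'a) \<in> monomial_span 1"
    using monomial_span_power[OF monomial_span_var_diff_1] by (intro monomial_span_prod) simp
  then show "(\<lambda>u. c n * (\<Prod>i\<in>UNIV. (u i - 1) ^ n i)) \<in> monomial_span M"
    using monomial_span_mult[OF monomial_span_const[OF assms(1)] _ assms(2), of _ 1] by simp
qed fact

lemma mult_le_of_le_one:
  fixes a b c :: real
  assumes "a \<le> 1" "b \<le> c" "0 \<le> a" "0 \<le> b"
  shows "a * b \<le> c"
  using mult_mono[OF assms(1,2)] assms by simp

text \<open>
  The interpolation operator at \<open>q\<close>-th roots of unity replaces \<open>u ^ j\<close> by \<open>u ^ (j mod q)\<close>. It is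
  a sum over the roots of unity divided by \<open>q ^ d\<close>; the denominator makes the second bound lossy.
\<close>

lemma monomial_span_interpolation:
  fixes g :: "('d::finite \<Rightarrow> 'a::complete_ultrametric_field) \<Rightarrow> 'a"
  assumes prim: "\<And>k. \<zeta> ^ k = 1 \<longleftrightarrow> q dvd k" and "0 < q"
    and g: "g \<in> monomial_span M" and "0 \<le> M" "0 \<le> \<omega>" "0 \<le> A"
    and u: "\<And>i. absval (u i) \<le> 1" "\<And>i. absval (u i ^ q - 1) \<le> \<omega>"
    and A: "\<And>t. t \<in> index_box q \<Longrightarrow> absval (g (\<lambda>i. \<zeta> ^ t i)) \<le> A"
  shows "absval (of_nat q :: 'a) ^ CARD('d) * absval (g u)
    \<le> max (absval (of_nat q :: 'a) ^ CARD('d) * (M * \<omega>)) A"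
proof -
  define Q where "Q = (of_nat q :: 'a) ^ CARD('d)"
  \<comment> \<open>\<open>Q\<close> times the interpolation operator, so that no division occurs:
    the inner sum extracts \<open>Q\<close> times the total coefficient of the exponents congruent
    to \<open>a\<close>.\<close>
  define L where "L g = (\<Sum>a\<in>index_box q. (\<Prod>i\<in>UNIV. u i ^ a i) *
      (\<Sum>t\<in>index_box q. (\<Prod>i\<in>UNIV. \<zeta> ^ (t i * (q - a i))) * g (\<lambda>i. \<zeta> ^ t i)))" for g
  have abs_\<zeta>: "absval \<zeta> = 1"
    using prim[of q] \<open>0 < q\<close> by (intro absval_root_of_unity) auto
  have "absval (L g) \<le> A"
    unfolding L_def
  proof (intro absval_sum_le \<open>0 \<le> A\<close>)
    fix a
    have "absval (\<Sum>t\<in>index_box q. (\<Prod>i\<in>UNIV. \<zeta> ^ (t i * (q - a i))) * g (\<lambda>i. \<zeta> ^ t i)) \<le> A"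
      using A by (intro absval_sum_le \<open>0 \<le> A\<close>) (simp add: absval_mult absval_prod absval_power abs_\<zeta>)
    moreover have "absval (\<Prod>i\<in>UNIV. u i ^ a i) \<le> 1"
      unfolding absval_prod absval_power using u(1) by (intro prod_le_1) (simp add: power_le_one)
    ultimately show "absval ((\<Prod>i\<in>UNIV. u i ^ a i) *
        (\<Sum>t\<in>index_box q. (\<Prod>i\<in>UNIV. \<zeta> ^ (t i * (q - a i))) * g (\<lambda>i. \<zeta> ^ t i))) \<le> A"
      unfolding absval_mult by (intro mult_le_of_le_one absval_nonneg)
  qed
  \<comment> \<open>The error is additive in \<open>g\<close> and the bound is ultrametric, so
    single monomials suffice.\<close>
  moreover have "absval (Q * g u - L g) \<le> absval Q * (M * \<omega>)"
    using g
  proof induction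
    case (monomial c j)
    let ?r = "\<lambda>i. j i mod q"
    have "L (\<lambda>u. c * (\<Prod>i\<in>UNIV. u i ^ j i)) = (\<Sum>a\<in>index_box q. (\<Prod>i\<in>UNIV. u i ^ a i) * (c *
        (\<Sum>t\<in>index_box q. (\<Prod>i\<in>UNIV. \<zeta> ^ (t i * (q - a i))) * (\<Prod>i\<in>UNIV. (\<zeta> ^ t i) ^ j i))))"
      by (simp add: L_def sum_distrib_left mult_ac)
    also have "\<dots> = (\<Sum>a\<in>index_box q. if a = ?r then c * (\<Prod>i\<in>UNIV. u i ^ ?r i) * Q else 0)"
      by (intro sum.cong refl, subst sum_index_box_roots_of_unity[OF prim])
        (auto simp: Q_def fun_eq_iff mult_ac)
    also have "\<dots> = c * (\<Prod>i\<in>UNIV. u i ^ ?r i) * Q"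
      using \<open>0 < q\<close> by (subst sum.delta[OF finite_index_box]) (auto simp: index_box_def)
    finally have L: "L (\<lambda>u. c * (\<Prod>i\<in>UNIV. u i ^ j i)) = c * (\<Prod>i\<in>UNIV. u i ^ ?r i) * Q" .
    have "absval (u i ^ j i - u i ^ ?r i) \<le> \<omega>" for i
    proof -
      \<comment> \<open>Division with remainder: the discrepancy comes from a power of
        \<open>u i ^ q\<close>, which is no further from \<open>1\<close> than
        \<open>u i ^ q\<close> itself.\<close>
      have "u i ^ j i = u i ^ ?r i * (u i ^ q) ^ (j i div q)"
        by (simp flip: power_mult power_add)
      then have "u i ^ j i - u i ^ ?r i = u i ^ ?r i * ((u i ^ q) ^ (j i div q) - 1)"
        by (simp add: algebra_simps)
      moreover have "absval ((u i ^ q) ^ (j i div q) - 1) \<le> \<omega>"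
        using u[of i] by (intro order_trans[OF absval_power_diff_1_le[of "u i ^ q"]])
          (simp_all add: absval_power power_le_one)
      ultimately show ?thesis
        using u(1)[of i]
        by (simp add: absval_mult absval_power power_le_one mult_le_of_le_one)
    qed
    then have "absval ((\<Prod>i\<in>UNIV. u i ^ j i) - (\<Prod>i\<in>UNIV. u i ^ ?r i)) \<le> \<omega>"
      using u(1) \<open>0 \<le> \<omega>\<close>
      by (intro absval_prod_diff_le) (auto simp: absval_power power_le_one)
    then have "absval Q * (absval c * absval ((\<Prod>i\<in>UNIV. u i ^ j i) - (\<Prod>i\<in>UNIV. u i ^ ?r i)))
        \<le> absval Q * (M * \<omega>)"
      using monomial \<open>0 \<le> M\<close> by (intro mult_left_mono mult_mono) auto
    then show ?case
      unfolding L by (simp add: algebra_simps flip: absval_mult)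
  next
    case (add f1 f2)
    have "L (\<lambda>u. f1 u + f2 u) = L f1 + L f2"
      by (simp add: L_def distrib_left sum.distrib)
    then have "Q * (f1 u + f2 u) - L (\<lambda>u. f1 u + f2 u) = (Q * f1 u - L f1) + (Q * f2 u - L f2)"
      by (simp add: algebra_simps)
    then show ?case
      using add.IH absval_add_le_max[of "Q * f1 u - L f1" "Q * f2 u - L f2"] by simp
  qed
  moreover have "absval (Q * g u) \<le> max (absval (Q * g u - L g)) (absval (L g))"
    using absval_add_le_max[of "Q * g u - L g" "L g"] by simp
  ultimately have "absval (Q * g u) \<le> max (absval Q * (M * \<omega>)) A"
    by linarith
  then show ?thesis
    by (simp add: Q_def absval_mult absval_power)
qed

section \<open>Cauchy estimates\<close>

text \<open>
  The coefficient is isolated by averaging over roots of unity of order \<open>l ^ e\<close> for a prime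
  \<open>l \<noteq> p\<close>, so that the denominator has absolute value \<open>1\<close>.
\<close>

lemma power_series_coeff_bound_at:
  fixes f :: "'a::complete_ultrametric_field ^ 'd::finite \<Rightarrow> 'a"
  assumes p: "prime p" and Cp: "is_Cp p TYPE('a)"
    and f: "power_series_on open_polydisc c f"
    and M: "\<And>z. z \<in> open_polydisc \<Longrightarrow> absval (f z) \<le> M" "0 < M"
    and w: "absval w < 1"
  shows "absval (c j * (\<Prod>i\<in>UNIV. w ^ j i)) \<le> M"
proof -
  define T where "T n z = c n * (\<Prod>i\<in>UNIV. (z $ i) ^ n i)" for n and z :: "'a ^ 'd"
  have sum_T: "((\<lambda>n. T n z) has_sum f z) UNIV" if "z \<in> open_polydisc" for z
    using f that by (simp add: power_series_on_def T_def)
  have approx: "\<exists>J. finite J \<and> (\<forall>K. finite K \<and> J \<subseteq> K \<longrightarrow> absval ((\<Sum>n\<in>K. T n z) - f z) < M)"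
    if "z \<in> open_polydisc" for z
    by (rule has_sum_approx[OF sum_T[OF that] M(2)]) blast
  define W where "W = (\<chi> i::'d. w)"
  have W: "W \<in> open_polydisc" using w by (simp add: W_def open_polydisc_def)
  \<comment> \<open>Outside \<open>F0\<close> every term at \<open>W\<close> is at most
    \<open>M\<close>, as a difference of two partial sums close to \<open>f W\<close>. This controls
    the terms that averaging cannot separate from \<open>j\<close>.\<close>
  obtain F0 where F0: "finite F0"
    "\<And>K. finite K \<Longrightarrow> F0 \<subseteq> K \<Longrightarrow> absval ((\<Sum>n\<in>K. T n W) - f W) < M"
    using approx[OF W] by blast
  have tail: "absval (T n W) \<le> M" if "n \<notin> F0" for n
  proof -
    have "T n W = ((\<Sum>n\<in>insert n F0. T n W) - f W) - ((\<Sum>n\<in>F0. T n W) - f W)"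
      using that F0(1) by simp
    moreover have "absval ((\<Sum>n\<in>insert n F0. T n W) - f W) < M" "absval ((\<Sum>n\<in>F0. T n W) - f W) < M"
      using F0(1) by (intro F0(2); blast)+
    ultimately show ?thesis
      using absval_diff_le_max[of "(\<Sum>n\<in>insert n F0. T n W) - f W" "(\<Sum>n\<in>F0. T n W) - f W"]
      by simp
  qed
  define l :: nat where "l = (if p = 2 then 3 else 2)"
  have l: "prime l" "\<not> p dvd l"
    using p primes_dvd_imp_eq[of p l] by (auto simp: l_def)
  \<comment> \<open>\<open>l ^ e\<close> exceeds all entries of \<open>j\<close> and of the
    multi-indices in \<open>F0\<close>, so distinct ones among these stay distinct modulo
    \<open>q\<close>.\<close>
  obtain e where e: "\<And>n i. n \<in> insert j F0 \<Longrightarrow> n i < l ^ e"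
  proof -
    have "finite (\<Union>n\<in>insert j F0. range n)" using F0(1) by auto
    then obtain b where "\<forall>m\<in>(\<Union>n\<in>insert j F0. range n). m < b"
      unfolding finite_nat_set_iff_bounded by blast
    then have b: "n i < b" if "n \<in> insert j F0" for n i
      using that by blast
    have "b < l ^ b" using l(1) by (intro power_gt_expt) (auto dest: prime_gt_1_nat)
    then show ?thesis using b by (intro that[of b]) (meson less_trans)
  qed
  define q where "q = l ^ e"
  have "\<not> p dvd q" using l(2) p prime_dvd_power[of p l e] by (auto simp: q_def)
  then have abs_q: "absval (of_nat q :: 'a) = 1"
    using absval_of_int_eq_1[OF p is_Cp_absval[OF Cp], of "int q"] by simp
  obtain \<zeta> :: 'a where \<zeta>: "\<And>k. \<zeta> ^ k = 1 \<longleftrightarrow> q dvd k"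
    using is_Cp_primitive_root[OF Cp l(1), of e] q_def by metis
  have q: "0 < q" using prime_gt_0_nat[OF l(1)] by (simp add: q_def)
  have abs_\<zeta>: "absval \<zeta> = 1"
    using \<zeta>[of q] q by (intro absval_root_of_unity) auto
  define Z where "Z t = (\<chi> i. \<zeta> ^ t i * w)" for t :: "'d \<Rightarrow> nat"
  have Z: "Z t \<in> open_polydisc" for t
    using w by (simp add: Z_def open_polydisc_def absval_mult absval_power abs_\<zeta>)
  have "\<forall>t. \<exists>J. finite J \<and> (\<forall>K. finite K \<and> J \<subseteq> K \<longrightarrow> absval ((\<Sum>n\<in>K. T n (Z t)) - f (Z t)) < M)"
    using approx[OF Z] by blast
  then obtain J where J: "\<And>t. finite (J t)"
    "\<And>t K. finite K \<Longrightarrow> J t \<subseteq> K \<Longrightarrow> absval ((\<Sum>n\<in>K. T n (Z t)) - f (Z t)) < M"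
    by metis
  define K where "K = insert j F0 \<union> (\<Union>t\<in>index_box q. J t)"
  have K: "finite K" using F0(1) J(1) by (simp add: K_def)
  have le: "absval (\<Sum>n\<in>K. T n (Z t)) \<le> M" if "t \<in> index_box q" for t
  proof -
    have "absval ((\<Sum>n\<in>K. T n (Z t)) - f (Z t)) < M"
      using J(2)[OF K] that by (auto simp: K_def)
    then show ?thesis
      using absval_add_le_max[of "(\<Sum>n\<in>K. T n (Z t)) - f (Z t)" "f (Z t)"] M(1)[OF Z[of t]]
      by simp
  qed
  have TZ: "T n (Z t) = T n W * (\<Prod>i\<in>UNIV. (\<zeta> ^ t i) ^ n i)" for n t
    by (simp add: T_def Z_def W_def power_mult_distrib prod.distrib mult_ac)
  have jbox: "j \<in> index_box q" using e by (simp add: index_box_def q_def)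
  \<comment> \<open>Averaging leaves the residue class of \<open>j\<close>; by the choice of
    \<open>e\<close> its other members lie outside \<open>F0\<close> and are covered by
    \<open>tail\<close>.\<close>
  define E where "E = {n \<in> K. \<forall>i. n i mod q = j i}"
  have "(\<Sum>t\<in>index_box q. (\<Prod>i\<in>UNIV. \<zeta> ^ (t i * (q - j i))) * (\<Sum>n\<in>K. T n (Z t)))
      = (\<Sum>n\<in>K. T n W *
          (\<Sum>t\<in>index_box q. (\<Prod>i\<in>UNIV. \<zeta> ^ (t i * (q - j i))) * (\<Prod>i\<in>UNIV. (\<zeta> ^ t i) ^ n i)))"
    unfolding TZ sum_distrib_left by (subst sum.swap) (simp add: mult_ac)
  also have "\<dots> = (\<Sum>n\<in>K. if \<forall>i. n i mod q = j i then T n W * of_nat q ^ CARD('d) else 0)"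
    by (intro sum.cong refl, subst sum_index_box_roots_of_unity[OF \<zeta> jbox]) auto
  also have "\<dots> = (\<Sum>n\<in>E. T n W) * of_nat q ^ CARD('d)"
    unfolding E_def sum.inter_filter[OF K] sum_distrib_right by (intro sum.cong) auto
  finally have avg: "(\<Sum>t\<in>index_box q. (\<Prod>i\<in>UNIV. \<zeta> ^ (t i * (q - j i))) * (\<Sum>n\<in>K. T n (Z t)))
      = (\<Sum>n\<in>E. T n W) * of_nat q ^ CARD('d)" .
  have "absval (\<Sum>t\<in>index_box q. (\<Prod>i\<in>UNIV. \<zeta> ^ (t i * (q - j i))) * (\<Sum>n\<in>K. T n (Z t))) \<le> M"
    using le M(2) by (intro absval_sum_le) (simp_all add: absval_mult absval_prod absval_power abs_\<zeta>)
  then have sum_E: "absval (\<Sum>n\<in>E. T n W) \<le> M"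
    unfolding avg by (simp add: absval_mult absval_power abs_q)
  have "j \<in> E" using jbox by (simp add: E_def K_def index_box_def)
  then have "T j W = (\<Sum>n\<in>E. T n W) - (\<Sum>n\<in>E - {j}. T n W)"
    using K by (simp add: E_def sum.remove[of _ j])
  moreover have "absval (\<Sum>n\<in>E - {j}. T n W) \<le> M"
  proof (intro absval_sum_le tail)
    fix n assume n: "n \<in> E - {j}"
    show "n \<notin> F0"
    proof
      assume "n \<in> F0"
      then have "n i < q" for i using e by (simp add: q_def)
      then have "n = j" using n by (auto simp: E_def fun_eq_iff)
      with n show False by simp
    qed
  qed (use M(2) in simp)
  ultimately have "absval (T j W) \<le> M"
    using sum_E absval_diff_le_max[of "\<Sum>n\<in>E. T n W" "\<Sum>n\<in>E - {j}. T n W"] by simp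
  then show ?thesis by (simp add: T_def W_def)
qed

text \<open>The factor \<open>absval w ^ s\<close> in the previous estimate is removed by letting
  \<open>absval w\<close> approach \<open>1\<close>, with \<open>w\<close> an \<open>N\<close>-th
  root of \<open>p\<close> and \<open>N\<close> large.\<close>

lemma power_series_coeff_bound:
  fixes f :: "'a::complete_ultrametric_field ^ 'd::finite \<Rightarrow> 'a"
  assumes p: "prime p" and Cp: "is_Cp p TYPE('a)"
    and f: "power_series_on open_polydisc c f"
    and M: "\<And>z. z \<in> open_polydisc \<Longrightarrow> absval (f z) \<le> M" "0 < M"
  shows "absval (c j) \<le> M"
proof (rule ccontr)
  assume "\<not> absval (c j) \<le> M"
  then have lt: "M < absval (c j)" by simp
  have p1: "1 < real p" using prime_gt_1_nat[OF p] by simp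
  define s where "s = (\<Sum>i\<in>UNIV. j i)"
  have "M / absval (c j) < 1" "0 < M / absval (c j)" using lt M(2) by simp_all
  \<comment> \<open>Chosen to contradict the \<open>N\<close>-th power of
    \<open>absval (c j) * absval w ^ s \<le> M\<close>, given
    \<open>absval w ^ N = 1 / p\<close>.\<close>
  then obtain N where N: "(M / absval (c j)) ^ N < (1 / real p) ^ s"
    using real_arch_pow_inv[of "(1 / real p) ^ s" "M / absval (c j)"] p1 by auto
  have N0: "N \<noteq> 0"
  proof
    assume "N = 0"
    moreover have "(1 / real p) ^ s \<le> 1" using p1 by (intro power_le_one) auto
    ultimately show False using N by simp
  qed
  let ?P = "monom 1 N - [:of_nat p:] :: 'a poly"
  have "coeff ?P i \<in> \<int>" for i
    by (auto simp: coeff_pCons split: nat.split)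
  moreover have "coeff ?P N = 1"
    using N0 by (simp add: coeff_pCons split: nat.split)
  then have "0 < degree ?P"
    using le_degree[of ?P N] N0 by simp
  ultimately obtain w where "poly ?P w = 0"
    using is_Cp_integral_root[OF Cp] by blast
  then have "w ^ N = of_nat p" by (simp add: poly_monom)
  then have w: "absval w ^ N = 1 / real p"
    using is_Cp_absval[OF Cp] by (simp flip: absval_power)
  then have "absval w < 1"
    using p1 one_le_power[of "absval w" N] by (cases "absval w < 1") auto
  then have "absval (c j) * absval w ^ s \<le> M"
    using power_series_coeff_bound_at[OF assms, of w j]
    by (simp add: absval_mult absval_prod absval_power s_def power_sum)
  then have "(absval (c j) * absval w ^ s) ^ N \<le> M ^ N"
    by (intro power_mono) auto
  moreover have "(absval w ^ s) ^ N = (1 / real p) ^ s"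
    by (simp add: mult.commute flip: w power_mult)
  ultimately have "absval (c j) ^ N * (1 / real p) ^ s \<le> M ^ N"
    by (simp add: power_mult_distrib)
  then have "(1 / real p) ^ s \<le> (M / absval (c j)) ^ N"
    using lt M(2) by (simp add: power_divide pos_le_divide_eq mult.commute)
  with N show False by simp
qed

section \<open>Torsion points determine the sup norm\<close>

text \<open>For given \<open>k\<close>, take \<open>n\<close> least such that the second bound is
  forced below \<open>B ^ k\<close>. Then \<open>P ^ n\<close> is of order
  \<open>(M / B) ^ k\<close>, so the first bound is at most a constant times
  \<open>(A * (M / B) ^ d) ^ k\<close>. Since \<open>A * (M / B) ^ d < B\<close>, it also falls
  below \<open>B ^ k\<close> for large \<open>k\<close>.\<close>

lemma exponential_bounds_contradiction:
  fixes P A B C M :: real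
  assumes P: "1 < P" and A: "0 < A" and B: "0 < B" "B \<le> M" "A * M ^ d < B ^ Suc d"
    and bound: "\<And>k n. B ^ k \<le> max ((P ^ n) ^ d * A ^ k) (M ^ k * (C / P ^ n))"
  shows False
proof -
  \<comment> \<open>With \<open>D \<ge> 1\<close> also \<open>D * R ^ k \<ge> 1\<close>, hence
    \<open>n \<noteq> 0\<close>, and minimality can be applied to the predecessor of
    \<open>n\<close>.\<close>
  define D where "D = max C 1"
  define R where "R = M / B"
  define r where "r = A * M ^ d / B ^ Suc d"
  have D: "1 \<le> D" "C \<le> D" by (simp_all add: D_def)
  have R: "1 \<le> R" using B by (simp add: R_def)
  have r: "0 < r" "r < 1"
    using A B by (simp_all add: r_def)
  obtain k where k: "r ^ k < 1 / (P * D) ^ d"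
    using real_arch_pow_inv[of "1 / (P * D) ^ d" r] r P D by auto
  define n where "n = (LEAST n. D * R ^ k < P ^ n)"
  have "\<exists>n. D * R ^ k < P ^ n"
    using real_arch_pow[OF P] .
  then have n: "D * R ^ k < P ^ n"
    unfolding n_def by (rule LeastI_ex)
  have "1 \<le> D * R ^ k"
    using mult_mono[of 1 D 1 "R ^ k"] D R one_le_power[OF R, of k] by simp
  then have "n \<noteq> 0" using n by (cases n) auto
  then obtain m where m: "n = Suc m" by (cases n) auto
  then have "\<not> D * R ^ k < P ^ m"
    unfolding n_def using not_less_Least by (metis lessI)
  then have le: "P ^ n \<le> P * D * R ^ k"
    using P m by simp
  have "(P ^ n) ^ d * A ^ k \<le> (P * D * R ^ k) ^ d * A ^ k"
    using le P A by (intro mult_right_mono power_mono) auto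
  also have "\<dots> = (P * D) ^ d * (R ^ d * A) ^ k"
    by (simp add: power_mult_distrib mult.commute flip: power_mult)
  also have "R ^ d * A = r * B"
    using B by (simp add: R_def r_def power_divide)
  also have "(P * D) ^ d * (r * B) ^ k = ((P * D) ^ d * r ^ k) * B ^ k"
    by (simp add: power_mult_distrib)
  also have "\<dots> < 1 * B ^ k"
    using k B P D by (intro mult_strict_right_mono) (auto simp: field_simps)
  finally have 1: "(P ^ n) ^ d * A ^ k < B ^ k" by simp
  have "M ^ k * (C / P ^ n) \<le> M ^ k * (D / P ^ n)"
    using B D P by (intro mult_left_mono divide_right_mono) auto
  also have "\<dots> = (D * R ^ k) / P ^ n * B ^ k"
    using B by (simp add: R_def power_divide)
  also have "\<dots> < 1 * B ^ k"
    using n B P by (intro mult_strict_right_mono) auto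
  finally have "M ^ k * (C / P ^ n) < B ^ k" by simp
  with 1 bound[of k n] show False by simp
qed

text \<open>
  The loss of \<open>q ^ d\<close> in the interpolation is absorbed by applying it to high powers of the
  function: this is harmless as long as \<open>q = p ^ n\<close> grows with a small exponential rate in the
  power, while the error \<open>u ^ q - 1\<close>, of size about \<open>1 / q\<close>, decays at that rate.
\<close>

lemma absval_le_of_torsion_points:
  fixes f :: "'a::complete_ultrametric_field ^ 'd::finite \<Rightarrow> 'a"
  assumes p: "prime p" and Cp: "is_Cp p TYPE('a)"
    and f: "power_series_on open_polydisc c f" "bounded_on open_polydisc f"
    and tors: "\<And>n \<zeta> t. (\<And>k. \<zeta> ^ k = 1 \<longleftrightarrow> p ^ n dvd k) \<Longrightarrow> absval (f (\<chi> i. \<zeta> ^ t i - 1)) \<le> A"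
    and z: "z \<in> open_polydisc"
  shows "absval (f z) \<le> A"
proof (rule ccontr)
  assume "\<not> absval (f z) \<le> A"
  then have Az: "A < absval (f z)" by simp
  have "0 \<le> A"
    using tors[of 1 0 "\<lambda>_. 0"] by (simp add: order_trans[OF absval_nonneg])
  define d where "d = CARD('d)"
  define M where "M = (SUP z\<in>open_polydisc. absval (f z))"
  have bdd: "bdd_above ((\<lambda>z. absval (f z)) ` open_polydisc)"
    using f(2) by (auto simp: bounded_on_def bdd_above_def)
  have M: "absval (f z) \<le> M" if "z \<in> open_polydisc" for z
    unfolding M_def using that bdd by (rule cSUP_upper)
  have "A < M" using Az M[OF z] by simp
  \<comment> \<open>\<open>A'\<close> is positive even if \<open>A = 0\<close>; it serves as the
    truncation tolerance at the torsion points and as the bound for the truncated series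
    there.\<close>
  then obtain A' where A': "A < A'" "A' < M" using dense by blast
  have A'0: "0 < A'" and M0: "0 < M" using A' \<open>0 \<le> A\<close> by simp_all
  have "A' * M ^ d < M ^ Suc d" using A'(2) M0 by simp
  \<comment> \<open>The threshold above which a value \<open>B\<close> satisfies
    \<open>A' * M ^ d < B ^ Suc d\<close>. It lies below the supremum \<open>M\<close>, so some
    \<open>y\<close> exceeds it; from here on \<open>y\<close> replaces \<open>z\<close>.\<close>
  define b where "b = root (Suc d) (A' * M ^ d)"
  have b: "b ^ Suc d = A' * M ^ d" "0 \<le> b"
    using A'0 M0 by (simp_all add: b_def del: power_Suc)
  have "b < M"
    using \<open>A' * M ^ d < M ^ Suc d\<close> M0 b(1) by (intro power_less_imp_less_base[of b "Suc d"]) auto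
  then obtain y where y: "y \<in> open_polydisc" "b < absval (f y)"
    unfolding M_def using bdd z by (subst (asm) less_cSUP_iff) auto
  define B where "B = absval (f y)"
  have B: "0 < B" "B \<le> M" using y b(2) M by (auto simp: B_def)
  have B3: "A' * M ^ d < B ^ Suc d"
    using power_strict_mono[OF y(2) b(2), of "Suc d"] unfolding b(1) B_def by simp
  have coeff: "absval (c j) \<le> M" for j
    using power_series_coeff_bound[OF p Cp f(1) M M0] .
  have abs_p: "absval (of_nat p :: 'a) = 1 / real p" using is_Cp_absval[OF Cp] .
  have p1: "1 < real p" using prime_gt_1_nat[OF p] by simp
  define u where "u i = 1 + y $ i" for i
  have u1: "absval (u i) = 1" for i
    using y(1) by (simp add: u_def open_polydisc_def absval_1_plus)
  have "\<exists>C. \<forall>n. absval (u i ^ (p ^ n) - 1) \<le> C / real p ^ n" for i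
  proof -
    have "absval (u i - 1) < 1" using y(1) by (simp add: u_def open_polydisc_def)
    then show ?thesis
      using absval_power_prime_power_diff_1_bound[OF p abs_p] by metis
  qed
  then obtain C where C: "\<And>i n. absval (u i ^ (p ^ n) - 1) \<le> C i / real p ^ n" by metis
  define C' where "C' = (\<Sum>i\<in>UNIV. \<bar>C i\<bar>)"
  have C'0: "0 \<le> C'" by (simp add: C'_def sum_nonneg)
  have "C i \<le> C'" for i
    using member_le_sum[of i UNIV "\<lambda>i. \<bar>C i\<bar>"] by (simp add: C'_def)
  then have C': "absval (u i ^ (p ^ n) - 1) \<le> C' / real p ^ n" for i n
    using p1 by (intro order_trans[OF C] divide_right_mono) auto
  define T where "T n z = c n * (\<Prod>i\<in>UNIV. (z $ i) ^ n i)" for n and z :: "'a ^ 'd"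
  have approx: "\<exists>J. finite J \<and> (\<forall>K. finite K \<and> J \<subseteq> K \<longrightarrow> absval ((\<Sum>n\<in>K. T n z) - f z) < r)"
    if "z \<in> open_polydisc" "0 < r" for z r
  proof -
    have "((\<lambda>n. T n z) has_sum f z) UNIV"
      using f(1) that(1) by (simp add: power_series_on_def T_def)
    then show ?thesis
      by (rule has_sum_approx[OF _ that(2)]) blast
  qed
  have "B ^ k \<le> max ((real p ^ n) ^ d * A' ^ k) (M ^ k * (C' / real p ^ n))" for k n
  proof -
    obtain \<zeta> :: 'a where \<zeta>: "\<And>k. \<zeta> ^ k = 1 \<longleftrightarrow> p ^ n dvd k"
      using is_Cp_primitive_root[OF Cp p] by metis
    define Z where "Z t = (\<chi> i. \<zeta> ^ t i - 1)" for t :: "'d \<Rightarrow> nat"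
    have Z: "Z t \<in> open_polydisc" for t
    proof -
      have "(\<zeta> ^ t i) ^ p ^ n = 1" for i
        using \<zeta>[of "t i * p ^ n"] by (simp add: power_mult)
      then show ?thesis
        using absval_prime_power_root_diff_1[OF p abs_p] by (auto simp: Z_def open_polydisc_def)
    qed
    have "\<forall>t. \<exists>J. finite J \<and>
        (\<forall>K. finite K \<and> J \<subseteq> K \<longrightarrow> absval ((\<Sum>n\<in>K. T n (Z t)) - f (Z t)) < A')"
      using approx[OF Z A'0] by blast
    then obtain J where J: "\<And>t. finite (J t)"
      "\<And>t K. finite K \<Longrightarrow> J t \<subseteq> K \<Longrightarrow> absval ((\<Sum>n\<in>K. T n (Z t)) - f (Z t)) < A'"
      by metis
    obtain J0 where J0: "finite J0"
      "\<And>K. finite K \<Longrightarrow> J0 \<subseteq> K \<Longrightarrow> absval ((\<Sum>n\<in>K. T n y) - f y) < B"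
      using approx[OF y(1) B(1)] by blast
    \<comment> \<open>One finite truncation serves \<open>y\<close> and all the torsion points
      \<open>Z t\<close>, so interpolation is applied to a polynomial \<open>g\<close>.\<close>
    define K where "K = J0 \<union> (\<Union>t\<in>index_box (p ^ n). J t)"
    have K: "finite K" using J0(1) J(1) by (simp add: K_def)
    define g where "g u = (\<Sum>n\<in>K. c n * (\<Prod>i\<in>UNIV. (u i - 1) ^ n i))" for u :: "'d \<Rightarrow> 'a"
    have "g \<in> monomial_span M"
      unfolding g_def using coeff M0 by (intro polynomial_in_monomial_span) auto
    then have gk: "(\<lambda>u. g u ^ k) \<in> monomial_span (M ^ k)"
      using M0 by (intro monomial_span_power) auto
    have "g u = (\<Sum>n\<in>K. T n y)" by (simp add: g_def u_def T_def)
    then have "absval (g u - f y) < B"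
      using J0(2)[OF K] by (simp add: K_def)
    \<comment> \<open>The error is smaller than \<open>absval (f y)\<close>, so truncation does not
      lower the absolute value.\<close>
    then have "B \<le> absval (g u)"
      using absval_diff_le_max[of "g u" "g u - f y"] by (simp add: B_def)
    have "absval (g (\<lambda>i. \<zeta> ^ t i)) \<le> A'" if "t \<in> index_box (p ^ n)" for t
    proof -
      have "g (\<lambda>i. \<zeta> ^ t i) = (\<Sum>n\<in>K. T n (Z t))" by (simp add: g_def Z_def T_def)
      then have "absval (g (\<lambda>i. \<zeta> ^ t i) - f (Z t)) < A'"
        using J(2)[OF K, of t] that by (auto simp: K_def)
      moreover have "absval (f (Z t)) \<le> A" unfolding Z_def using tors[OF \<zeta>] .
      ultimately show ?thesis
        using A'(1) absval_add_le_max[of "g (\<lambda>i. \<zeta> ^ t i) - f (Z t)" "f (Z t)"] by simp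
    qed
    then have "absval (g (\<lambda>i. \<zeta> ^ t i) ^ k) \<le> A' ^ k" if "t \<in> index_box (p ^ n)" for t
      using that by (simp add: absval_power power_mono)
    then have "absval (of_nat (p ^ n) :: 'a) ^ d * absval (g u ^ k)
        \<le> max (absval (of_nat (p ^ n) :: 'a) ^ d * (M ^ k * (C' / real p ^ n))) (A' ^ k)"
      unfolding d_def using M0 A'0 C'0 u1 C' prime_gt_0_nat[OF p]
      by (intro monomial_span_interpolation[OF \<zeta> _ gk]) auto
    then have "(real p ^ n) ^ d * (absval (of_nat (p ^ n) :: 'a) ^ d * absval (g u ^ k))
        \<le> (real p ^ n) ^ d *
          max (absval (of_nat (p ^ n) :: 'a) ^ d * (M ^ k * (C' / real p ^ n))) (A' ^ k)"
      by (intro mult_left_mono) auto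
    \<comment> \<open>As \<open>absval (p ^ n) = 1 / p ^ n\<close>, this scaling moves the whole
      loss \<open>(p ^ n) ^ d\<close> to the bound at the torsion points.\<close>
    moreover have cancel: "(real p ^ n) ^ d * (absval (of_nat (p ^ n) :: 'a) ^ d * x) = x" for x
      using p1 by (simp add: absval_power abs_p power_divide)
    moreover have "0 \<le> (real p ^ n) ^ d" by simp
    ultimately have "absval (g u ^ k) \<le> max (M ^ k * (C' / real p ^ n)) ((real p ^ n) ^ d * A' ^ k)"
      by (simp only: max_mult_distrib_left cancel if_True)
    moreover have "B ^ k \<le> absval (g u ^ k)"
      unfolding absval_power using \<open>B \<le> absval (g u)\<close> B(1) by (intro power_mono) auto
    ultimately show ?thesis by linarith
  qed
  then show False
    by (rule exponential_bounds_contradiction[OF p1 A'0 B B3])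
qed

section \<open>Characters of finite order\<close>

lemma Zp_add:
  assumes "x \<in> Zp" "y \<in> Zp"
  shows "x + y \<in> (Zp :: 'a::complete_ultrametric_field set)"
proof -
  obtain a b where "\<And>n. a n \<in> \<rat>" "a \<longlonglongrightarrow> x" "\<And>n. b n \<in> \<rat>" "b \<longlonglongrightarrow> y"
    using assms unfolding Zp_def Qp_def closure_sequential by blast
  then have "\<And>n. a n + b n \<in> \<rat>" "(\<lambda>n. a n + b n) \<longlonglongrightarrow> x + y"
    by (auto intro: tendsto_add)
  then have "x + y \<in> Qp"
    unfolding Qp_def closure_sequential by (intro exI[of _ "\<lambda>n. a n + b n"]) simp
  then show ?thesis
    using assms absval_add_le_max[of x y] unfolding Zp_def by force
qed

lemma Zp_of_nat: "of_nat n \<in> (Zp :: 'a::complete_ultrametric_field set)"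
  using closure_subset[of "\<rat> :: 'a set"] by (auto simp: Zp_def Qp_def)

lemma Zp_of_nat_mult:
  assumes "x \<in> Zp"
  shows "of_nat n * x \<in> (Zp :: 'a::complete_ultrametric_field set)"
proof (induction n)
  case 0
  then show ?case using Zp_of_nat[of 0, where 'a='a] by simp
next
  case (Suc n)
  then show ?case using Zp_add[OF assms Suc] by (simp add: distrib_right)
qed

text \<open>Approximate \<open>x\<close> by a reduced fraction \<open>a / b\<close>. Its absolute
  value is at most \<open>1\<close>, so \<open>b\<close> is prime to \<open>p\<close> and invertible
  modulo \<open>p ^ n\<close>; the fraction is then close to an integer and to its residue.\<close>

lemma Zp_approx_nat:
  fixes x :: "'a::complete_ultrametric_field"
  assumes p: "prime p" "absval (of_nat p :: 'a) = 1 / real p" and x: "x \<in> Zp"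
  obtains k :: nat where "absval (x - of_nat k) \<le> (1 / real p) ^ n"
proof -
  have p1: "1 < real p" using prime_gt_1_nat[OF p(1)] by simp
  have pow: "absval ((of_nat p :: 'a) ^ n) = (1 / real p) ^ n"
    by (simp add: absval_power p(2))
  have pow1: "(1 / real p) ^ n \<le> 1" using p1 by (intro power_le_one) auto
  obtain y where y: "y \<in> \<rat>" "absval (y - x) < (1 / real p) ^ n"
  proof -
    have "0 < (1 / real p) ^ n" using p1 by simp
    then show ?thesis
      using x that unfolding Zp_def Qp_def closure_approachable dist_absval by blast
  qed
  obtain a b where ab: "0 < b" "coprime a b" "y = of_int a / of_int b"
    using y(1) by (rule Rats_cases')
  have "absval y \<le> 1"
    using absval_add_le_max[of "y - x" x] y(2) x pow1 by (auto simp: Zp_def)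
  have ndvd: "\<not> int p dvd b"
  proof
    assume "int p dvd b"
    then have "absval (of_int b :: 'a) \<le> 1 / real p"
      using absval_of_int_le_power_iff[OF p, of b 1] by simp
    also have "\<dots> < 1" using p1 by simp
    finally have "absval (of_int b :: 'a) < 1" .
    moreover have "\<not> int p dvd a"
      using \<open>int p dvd b\<close> ab(2) p(1) by (metis coprime_common_divisor not_prime_unit prime_nat_int_transfer)
    then have "absval (of_int a :: 'a) = 1"
      by (rule absval_of_int_eq_1[OF p])
    moreover have "absval (of_int b :: 'a) > 0" using ab(1) by (simp add: less_le)
    ultimately have "1 < absval y"
      by (simp add: ab(3) absval_divide)
    with \<open>absval y \<le> 1\<close> show False by simp
  qed
  then have abs_b: "absval (of_int b :: 'a) = 1"
    by (rule absval_of_int_eq_1[OF p])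
  have "coprime (int p) b"
    using ndvd p(1) by (intro prime_imp_coprime) auto
  then have "coprime (int p ^ n) b" by simp
  then obtain v w where vw: "w * int p ^ n + v * b = 1"
    using bezout_int[of "int p ^ n" b] by auto
  \<comment> \<open>By the Bezout identity \<open>v\<close> inverts \<open>b\<close> modulo
    \<open>p ^ n\<close>.\<close>
  define m where "m = a * v"
  have "b \<noteq> 0" using ab(1) by simp
  have "a - m * b = (a * w) * int p ^ n"
  proof -
    have "a = a * (w * int p ^ n + v * b)" by (simp add: vw)
    then show ?thesis by (simp add: m_def algebra_simps)
  qed
  then have num: "of_int a - of_int m * of_int b = (of_int (a * w) * of_nat p ^ n :: 'a)"
    by (metis of_int_diff of_int_mult of_int_of_nat_eq of_int_power)
  have ymb: "(y - of_int m) * of_int b = of_int (a * w) * of_nat p ^ n"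
  proof -
    have "y * of_int b = of_int a" using \<open>b \<noteq> 0\<close> by (simp add: ab(3))
    then show ?thesis using num by (simp only: left_diff_distrib)
  qed
  have "absval (y - of_int m) = absval (of_int (a * w) :: 'a) * (1 / real p) ^ n"
    using arg_cong[OF ymb, of absval]
    by (simp only: absval_mult[of "y - of_int m"] absval_mult[of "of_int (a * w)"] abs_b pow mult_1_right)
  then have ym: "absval (y - of_int m) \<le> (1 / real p) ^ n"
    using absval_of_int_le_1[of "a * w", where 'a='a]
    by (simp add: mult_left_le_one_le del: of_int_mult)
  define k where "k = nat (m mod int p ^ n)"
  have k: "int k = m mod int p ^ n"
    using p1 by (simp add: k_def)
  have "int (p ^ n) dvd (m - int k)"
    unfolding k by (simp add: minus_mod_eq_div_mult)
  then have mk: "absval (of_int (m - int k) :: 'a) \<le> (1 / real p) ^ n"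
    using absval_of_int_le_power_iff[OF p] by blast
  have "absval ((y - of_int m) + of_int (m - int k)) \<le> (1 / real p) ^ n"
    using ym mk absval_add_le_max[of "y - of_int m" "of_int (m - int k)"] by simp
  then have "absval (y - of_nat k) \<le> (1 / real p) ^ n"
    by simp
  then have "absval (x - of_nat k) \<le> (1 / real p) ^ n"
    using y(2) absval_diff_le_max[of "y - of_nat k" "y - x"] by simp
  then show ?thesis by (rule that)
qed

text \<open>The character sends the element with coordinates \<open>c i\<close> to the product of
  the \<open>\<zeta> ^ (t i * c i)\<close>, with \<open>p\<close>-adic exponents read modulo
  \<open>p ^ n\<close>. It is trivial on \<open>p ^ n\<close> times the integers of
  \<open>F\<close>, hence locally constant.\<close>

lemma torsion_point_in_character_variety:
  fixes F :: "'a::complete_ultrametric_field set" and e :: "'d::finite \<Rightarrow> 'a"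
  assumes p: "prime p" "absval (of_nat p :: 'a) = 1 / real p"
    and F: "is_subfield F" and e: "is_basis Zp (integers_of F) e"
    and \<zeta>: "\<And>k. \<zeta> ^ k = 1 \<longleftrightarrow> p ^ n dvd k"
  shows "(\<chi> i. \<zeta> ^ t i - 1) \<in> character_variety F e"
proof -
  let ?O = "integers_of F"
  define \<epsilon> where "\<epsilon> = (1 / real p) ^ n"
  have p1: "1 < real p" using prime_gt_1_nat[OF p(1)] by simp
  have \<epsilon>: "0 < \<epsilon>" using p1 by (simp add: \<epsilon>_def)
  have F_ops: "0 \<in> F" "1 \<in> F" "\<And>x y. x \<in> F \<Longrightarrow> y \<in> F \<Longrightarrow> x - y \<in> F"
    "\<And>x y. x \<in> F \<Longrightarrow> y \<in> F \<Longrightarrow> x * y \<in> F" "\<And>x. x \<in> F \<Longrightarrow> inverse x \<in> F"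
    using F by (auto simp: is_subfield_def)
  have F_add: "x + y \<in> F" if "x \<in> F" "y \<in> F" for x y
    using F_ops(3)[OF that(1) F_ops(3)[OF F_ops(1) that(2)]] by simp
  have F_nat: "of_nat m \<in> F" for m
    by (induction m) (auto intro: F_add F_ops)
  have O_add: "x + y \<in> ?O" if "x \<in> ?O" "y \<in> ?O" for x y
    using that F_add absval_add_le_max[of x y] by (auto simp: integers_of_def)

  define co where "co x = (THE c. range c \<subseteq> Zp \<and> x = (\<Sum>i\<in>UNIV. c i * e i))" for x
  have ex1: "\<exists>!c. range c \<subseteq> Zp \<and> x = (\<Sum>i\<in>UNIV. c i * e i)" if "x \<in> ?O" for x
    using e that by (simp add: is_basis_def)
  have co: "co x i \<in> Zp" "x = (\<Sum>i\<in>UNIV. co x i * e i)" if "x \<in> ?O" for x i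
    using theI'[OF ex1[OF that]] by (auto simp: co_def)
  have co_eq: "co x = c" if "x \<in> ?O" "range c \<subseteq> Zp" "x = (\<Sum>i\<in>UNIV. c i * e i)" for x c
    unfolding co_def using that by (intro the1_equality[OF ex1[OF that(1)]]) auto
  have co_add: "co (x + y) = (\<lambda>i. co x i + co y i)" if "x \<in> ?O" "y \<in> ?O" for x y
  proof (rule co_eq[OF O_add[OF that]])
    show "range (\<lambda>i. co x i + co y i) \<subseteq> Zp" using co(1) that by (auto intro: Zp_add)
    show "x + y = (\<Sum>i\<in>UNIV. (co x i + co y i) * e i)"
      by (simp add: distrib_right sum.distrib flip: co(2)[OF that(1)] co(2)[OF that(2)])
  qed
  have e_O: "e i \<in> ?O" for i using e by (auto simp: is_basis_def)
  have co_e: "co (e i) = (\<lambda>k. if k = i then 1 else 0)" for i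
  proof (rule co_eq[OF e_O])
    show "range (\<lambda>k. if k = i then 1 else 0 :: 'a) \<subseteq> Zp"
      using Zp_of_nat[of 0, where 'a='a] Zp_of_nat[of 1, where 'a='a] by auto
    show "e i = (\<Sum>k\<in>UNIV. (if k = i then 1 else 0) * e k)"
      by (simp add: if_distrib[of "\<lambda>x. x * _"] cong: if_cong)
  qed

  have root_cong: "\<zeta> ^ k = \<zeta> ^ m" if "absval (of_nat k - of_nat m :: 'a) \<le> \<epsilon>" for k m
    using that
  proof (induction k m rule: linorder_wlog)
    case (le k m)
    have "absval (of_int (int k - int m) :: 'a) \<le> (1 / real p) ^ n"
      using le by (simp add: \<epsilon>_def)
    then have "int (p ^ n) dvd int k - int m"
      using absval_of_int_le_power_iff[OF p] by blast
    then have "int (p ^ n) dvd int (m - k)"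
      using le(1) by (metis dvd_minus_iff minus_diff_eq of_nat_diff)
    then have "\<zeta> ^ (m - k) = 1" using \<zeta> by (metis of_nat_dvd_iff)
    then show ?case
      using le(1) by (metis le_add_diff_inverse mult.right_neutral power_add)
  next
    case (sym k m)
    then show ?case by (metis absval_minus minus_diff_eq)
  qed
  \<comment> \<open>\<open>\<phi> c\<close> plays the role of \<open>\<zeta> ^ c\<close> for a
    \<open>p\<close>-adic integer \<open>c\<close>; by \<open>root_cong\<close> the choice of
    approximating exponent is immaterial.\<close>
  define \<phi> where "\<phi> c = \<zeta> ^ (SOME k::nat. absval (c - of_nat k) \<le> \<epsilon>)" for c :: 'a
  have \<phi>: "\<phi> c = \<zeta> ^ k" if "absval (c - of_nat k) \<le> \<epsilon>" for c k
  proof -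
    let ?m = "SOME k::nat. absval (c - of_nat k) \<le> \<epsilon>"
    have "absval (c - of_nat ?m) \<le> \<epsilon>"
      using that by (rule someI)
    then have "absval ((c - of_nat k) - (c - of_nat ?m)) \<le> \<epsilon>"
      using that absval_diff_le_max[of "c - of_nat k" "c - of_nat ?m"] by linarith
    then have "absval (of_nat ?m - of_nat k :: 'a) \<le> \<epsilon>"
      by simp
    then show ?thesis unfolding \<phi>_def by (rule root_cong)
  qed
  have approx: "\<exists>k::nat. absval (c - of_nat k) \<le> \<epsilon>" if "c \<in> Zp" for c :: 'a
    unfolding \<epsilon>_def by (rule Zp_approx_nat[OF p that, of n]) (rule exI)
  have \<phi>_add: "\<phi> (c + c') = \<phi> c * \<phi> c'" if "c \<in> Zp" "c' \<in> Zp" for c c'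
  proof -
    obtain k k' where k: "absval (c - of_nat k) \<le> \<epsilon>" "absval (c' - of_nat k') \<le> \<epsilon>"
      using approx[OF \<open>c \<in> Zp\<close>] approx[OF \<open>c' \<in> Zp\<close>] by blast
    then have "absval ((c - of_nat k) + (c' - of_nat k')) \<le> \<epsilon>"
      using absval_add_le_max[of "c - of_nat k" "c' - of_nat k'"] by simp
    then have "absval (c + c' - of_nat (k + k')) \<le> \<epsilon>"
      by (simp add: algebra_simps)
    from \<phi>[OF this] show ?thesis
      using \<phi>[OF k(1)] \<phi>[OF k(2)] by (simp add: power_add)
  qed
  have \<phi>_small: "\<phi> c = 1" if "absval c \<le> \<epsilon>" for c
    using \<phi>[of c 0] that by simp
  have \<phi>_1: "\<phi> 1 = \<zeta>"
    using \<phi>[of 1 1] \<epsilon> by simp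
  have \<zeta>0: "\<zeta> \<noteq> 0"
  proof
    assume "\<zeta> = 0"
    moreover have "\<zeta> ^ (p ^ n) = 1" using \<zeta>[of "p ^ n"] by simp
    ultimately show False using prime_gt_0_nat[OF p(1)] by (simp add: power_0_left)
  qed

  define \<kappa> where "\<kappa> x = (\<Prod>i\<in>UNIV. \<phi> (co x i) ^ t i)" for x
  have \<kappa>_add: "\<kappa> (x + y) = \<kappa> x * \<kappa> y" if "x \<in> ?O" "y \<in> ?O" for x y
    unfolding \<kappa>_def co_add[OF that] using \<phi>_add co(1) that
    by (simp add: power_mult_distrib prod.distrib)
  have \<kappa>_0: "\<kappa> x \<noteq> 0" for x
    unfolding \<kappa>_def \<phi>_def using \<zeta>0 by simp
  \<comment> \<open>Since \<open>\<epsilon>\<close> is the absolute value of \<open>p ^ n\<close>,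
    dividing \<open>v\<close> by \<open>p ^ n\<close> stays in the integers of \<open>F\<close>;
    hence the coordinates of \<open>v\<close> are divisible by \<open>p ^ n\<close>.\<close>
  have \<kappa>_small: "\<kappa> v = 1" if "v \<in> F" "absval v \<le> \<epsilon>" for v
  proof -
    let ?P = "of_nat (p ^ n) :: 'a"
    have absP: "absval ?P = \<epsilon>" by (simp add: absval_power p(2) \<epsilon>_def)
    have "?P \<noteq> 0" using prime_gt_0_nat[OF p(1)] by simp
    define w where "w = inverse ?P * v"
    have "w \<in> F"
      unfolding w_def by (rule F_ops(4)[OF F_ops(5)[OF F_nat] that(1)])
    moreover have "absval w \<le> 1"
      unfolding w_def absval_mult absval_inverse absP using that(2) \<epsilon> by (simp add: field_simps)
    ultimately have w: "w \<in> ?O" by (simp add: integers_of_def)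
    have v: "v = ?P * w" using \<open>?P \<noteq> 0\<close> by (simp add: w_def)
    have "\<epsilon> \<le> 1" unfolding \<epsilon>_def using p1 by (intro power_le_one) auto
    then have vO: "v \<in> ?O" using that by (simp add: integers_of_def)
    have "co v = (\<lambda>i. ?P * co w i)"
    proof (rule co_eq[OF vO])
      show "range (\<lambda>i. ?P * co w i) \<subseteq> Zp" using co(1)[OF w] Zp_of_nat_mult by blast
      show "v = (\<Sum>i\<in>UNIV. (?P * co w i) * e i)"
        by (simp only: mult.assoc flip: sum_distrib_left co(2)[OF w] v)
    qed
    moreover have "absval (?P * co w i) \<le> \<epsilon>" for i
      unfolding absval_mult absP using co(1)[OF w, of i] \<epsilon> by (simp add: Zp_def mult_left_le)
    ultimately show ?thesis
      unfolding \<kappa>_def using \<phi>_small by simp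
  qed
  have \<kappa>_near: "\<kappa> x = \<kappa> a" if "x \<in> ?O" "a \<in> ?O" "absval (x - a) < \<epsilon>" for x a
  proof -
    have v: "x - a \<in> F" "x - a \<in> ?O"
      using that F_ops(3) absval_diff_le_max[of x a] by (auto simp: integers_of_def)
    then have "\<kappa> (x - a) = 1" using that(3) by (intro \<kappa>_small) auto
    then show ?thesis using \<kappa>_add[OF v(2) that(2)] by simp
  qed
  have "continuous_character ?O \<kappa>"
    unfolding continuous_character_def
  proof (intro conjI ballI)
    show "continuous_on ?O \<kappa>"
      unfolding continuous_on_iff dist_absval
      using \<kappa>_near \<epsilon> by (metis absval_0 diff_self)
  qed (use \<kappa>_0 \<kappa>_add in auto)
  moreover have "locally_analytic ?O \<kappa>"
    unfolding locally_analytic_def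
  proof (intro ballI exI conjI impI)
    fix a x assume *: "a \<in> ?O" "x \<in> ?O" "absval (x - a) < \<epsilon>"
    \<comment> \<open>The expansion at \<open>a\<close> is constant, with the same radius
      \<open>\<epsilon>\<close> for all \<open>a\<close>.\<close>
    have "(\<lambda>m. (if m = 0 then \<kappa> a else 0) * (x - a) ^ m) = (\<lambda>m. if m = 0 then \<kappa> x else 0)"
      using \<kappa>_near[OF *(2,1,3)] by auto
    then show "(\<lambda>m. (if m = 0 then \<kappa> a else 0) * (x - a) ^ m) sums \<kappa> x"
      using sums_single[of 0 "\<lambda>_. \<kappa> x"] by simp
  qed (rule \<epsilon>)
  moreover have "\<kappa> (e i) = \<zeta> ^ t i" for i
  proof -
    have "\<kappa> (e i) = (\<Prod>k\<in>UNIV. if k = i then \<zeta> ^ t k else 1)"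
      unfolding \<kappa>_def co_e using \<phi>_1 \<phi>_small[of 0] \<epsilon> by (intro prod.cong) auto
    then show ?thesis by simp
  qed
  then have "(\<chi> i. \<zeta> ^ t i - 1) = character_point e \<kappa>"
    by (simp add: character_point_def)
  moreover have "(\<chi> i. \<zeta> ^ t i - 1) \<in> open_polydisc"
  proof -
    have "(\<zeta> ^ t i) ^ p ^ n = 1" for i
      using \<zeta>[of "t i * p ^ n"] by (simp add: power_mult)
    then show ?thesis
      using absval_prime_power_root_diff_1[OF p] by (auto simp: open_polydisc_def)
  qed
  ultimately show ?thesis
    unfolding character_variety_def by blast
qed

section \<open>Restriction of bounded functions to the character variety\<close>

theorem theoremC:
  fixes p :: nat
    and F :: "'a::complete_ultrametric_field set"
    and e :: "'d::finite \<Rightarrow> 'a"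
  defines "X \<equiv> character_variety F e"
  defines "res \<equiv> (\<lambda>f :: 'a ^ 'd \<Rightarrow> 'a. restrict f X)"
  assumes "prime p"
    and "is_Cp p TYPE('a)"
    and "is_extension_of_Qp TYPE('d) F"
    and "is_basis Zp (integers_of F) e"
  shows "res \<in> Ob_polydisc \<rightarrow> Ob X \<and>
    (\<forall>f\<in>Ob_polydisc. \<forall>g\<in>Ob_polydisc.
       sup_norm X (\<lambda>z. res f z - res g z) = sup_norm open_polydisc (\<lambda>z. f z - g z))"
proof (intro conjI funcsetI ballI)
  have X_sub: "X \<subseteq> open_polydisc" by (auto simp: X_def character_variety_def)
  show "res f \<in> Ob X" if f: "f \<in> Ob_polydisc" for f
  proof -
    obtain c where c: "power_series_on open_polydisc c f"
      using f by (auto simp: Ob_polydisc_def rigid_functions_polydisc_def)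
    have "closed_polydisc r \<subseteq> (open_polydisc :: ('a ^ 'd) set)" if "r < 1" for r
      using that by (auto simp: closed_polydisc_def open_polydisc_def intro: le_less_trans)
    \<comment> \<open>One expansion on the whole open polydisc serves every radius
      \<open>r < 1\<close>.\<close>
    then have "power_series_on (closed_polydisc r) c f" if "r < 1" for r
      using c that unfolding power_series_on_def by blast
    then have "res f \<in> rigid_functions X"
      unfolding rigid_functions_def res_def by auto
    moreover have "bounded_on X (res f)"
      using f X_sub unfolding Ob_polydisc_def bounded_on_def res_def by fastforce
    ultimately show ?thesis by (simp add: Ob_def)
  qed
  show "sup_norm X (\<lambda>z. res f z - res g z) = sup_norm open_polydisc (\<lambda>z. f z - g z)"
    if f: "f \<in> Ob_polydisc" and g: "g \<in> Ob_polydisc" for f g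
  proof -
    \<comment> \<open>Isometry concerns distances, so the torsion point estimate is applied to the
      difference, again a bounded function given by a power series.\<close>
    define h where "h z = f z - g z" for z
    obtain a b where "power_series_on open_polydisc a f" "power_series_on open_polydisc b g"
      using f g by (auto simp: Ob_polydisc_def rigid_functions_polydisc_def)
    then have ps: "power_series_on open_polydisc (\<lambda>n. a n - b n) h"
      by (auto simp: power_series_on_def h_def has_sum_def left_diff_distrib sum_subtractf[abs_def]
          intro!: tendsto_diff)
    obtain M N where "\<And>z. z \<in> open_polydisc \<Longrightarrow> absval (f z) \<le> M"
      "\<And>z. z \<in> open_polydisc \<Longrightarrow> absval (g z) \<le> N"
      using f g by (auto simp: Ob_polydisc_def bounded_on_def)
    then have "absval (h z) \<le> max M N" if "z \<in> open_polydisc" for z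
      unfolding h_def using that by (intro order_trans[OF absval_diff_le_max] max.mono)
    then have bd: "bounded_on open_polydisc h"
      unfolding bounded_on_def by blast
    then have bdd: "bdd_above ((\<lambda>z. absval (h z)) ` open_polydisc)"
      by (auto simp: bounded_on_def bdd_above_def)
    have bdd_X: "bdd_above ((\<lambda>z. absval (h z)) ` X)"
      using bdd X_sub by (meson bdd_above_mono image_mono)
    have sup_X: "sup_norm X (\<lambda>z. res f z - res g z) = (SUP z\<in>X. absval (h z))"
      unfolding sup_norm_def h_def res_def by (intro SUP_cong) auto
    have tors: "(\<chi> i. \<zeta> ^ t i - 1) \<in> X" if "\<And>k. \<zeta> ^ k = 1 \<longleftrightarrow> p ^ n dvd k" for n \<zeta> t
      unfolding X_def using assms(3-6) that
      by (intro torsion_point_in_character_variety[OF _ is_Cp_absval])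
        (auto simp: is_extension_of_Qp_def)
    \<comment> \<open>The origin, the point of the trivial character, makes \<open>X\<close>
      nonempty, as the comparison of suprema requires.\<close>
    have "(\<chi> i. 1 ^ 0 - 1) \<in> X" by (rule tors[of 1 0 "\<lambda>_. 0"]) simp
    then have "X \<noteq> {}" by blast
    have "absval (h z) \<le> (SUP z\<in>X. absval (h z))" if "z \<in> open_polydisc" for z
    proof (rule absval_le_of_torsion_points[OF assms(3,4) ps bd _ that])
      fix n t and \<zeta> :: 'a
      assume "\<And>k. \<zeta> ^ k = 1 \<longleftrightarrow> p ^ n dvd k"
      then have "(\<chi> i. \<zeta> ^ t i - 1) \<in> X" by (rule tors)
      then show "absval (h (\<chi> i. \<zeta> ^ t i - 1)) \<le> (SUP z\<in>X. absval (h z))"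
        using bdd_X by (rule cSUP_upper)
    qed
    then have "(SUP z\<in>open_polydisc. absval (h z)) \<le> (SUP z\<in>X. absval (h z))"
      using X_sub \<open>X \<noteq> {}\<close> by (intro cSUP_least) auto
    moreover have "(SUP z\<in>X. absval (h z)) \<le> (SUP z\<in>open_polydisc. absval (h z))"
      using X_sub \<open>X \<noteq> {}\<close> bdd by (intro cSUP_subset_mono) auto
    ultimately show ?thesis
      unfolding sup_X by (simp add: sup_norm_def h_def)
  qed
qed

end
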